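(* Let $V$ be an irreducible Harish-Chandra module over the loop-Virasoro algebra $\mathcal{L}=\mathrm{Vir}\otimes\mathbb{C}[t^{\pm1}]$. Then $V$ is either a highest weight module, a lowest weight module, or a uniformly bounded module.
   Context: The Virasoro algebra $\mathrm{Vir}$ is the complex Lie algebra with basis $\{c,d_i : i\in\mathbb{Z}\}$ and brackets $[d_m,d_n]=(n-m)d_{m+n}+\delta_{m,-n}\frac{m^3-m}{12}c$, $[d_m,c]=0$. The loop-Virasoro algebra is $\mathcal{L}=\mathrm{Vir}\otimes\mathbb{C}[t^{\pm1}]$ with brackets $[d_i\otimes t^j,d_k\otimes t^l]=(k-i)\,d_{i+k}\otimes t^{j+l}+\delta_{i+k,0}\frac{i^3-i}{12}\,c\otimes t^{j+l}$, $[d_i\otimes t^j,c\otimes t^l]=0=[c\otimes t^j,c\otimes t^l]$. Write $d_i=d_i\otimes 1$, $c=c\otimes1$. Let $\mathcal{L}_i=(\mathbb{C}d_i\oplus\delta_{i,0}\mathbb{C}c)\otimes\mathbb{C}[t^{\pm1}]$, $\mathcal{L}_+=\bigoplus_{i>0}\mathcal{L}_i$, $\mathcal{L}_-=\bigoplus_{i<0}\mathcal{L}_i$; then $\mathcal{L}=\mathcal{L}_-\oplus\mathcal{L}_0\oplus\mathcal{L}_+$. For a module $V$ and $\lambda\in\mathbb{C}$, the weight space is $V_\lambda=\{v\in V: d_0v=\lambda v\}$. $V$ is a weight module if it is the sum of its weight spaces; a Harish-Chandra module is a weight module all of whose weight spaces are finite-dimensional. A weight module $V$ is uniformly bounded if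 there is $N\in\mathbb{N}$ with $\dim V_\lambda<N$ for all $\lambda$ with $V_\lambda\ne0$. For a linear map $\varphi:\mathcal{L}_0\to\mathbb{C}$, let $\mathbb{C}v_0$ be the one-dimensional $(\mathcal{L}_0+\mathcal{L}_+)$-module with $\mathcal{L}_+v_0=0$ and $xv_0=\varphi(x)v_0$ for $x\in\mathcal{L}_0$; let $\bar V(\varphi)=U(\mathcal{L})\otimes_{U(\mathcal{L}_0+\mathcal{L}_+)}\mathbb{C}v_0$ and let $V(\varphi)$ be the quotient of $\bar V(\varphi)$ by its unique maximal proper submodule. An irreducible module is a highest weight module if it is isomorphic to some $V(\varphi)$; lowest weight modules are defined analogously, with $\mathcal{L}_-$ in place of $\mathcal{L}_+$. *)

theory Defs
  imports Complex_Main "HOL-Library.Poly_Mapping" "HOL-Algebra.Free_Abelian_Groups"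
begin

subsection \<open>The loop-Virasoro algebra\<close>

datatype vir_basis = D int | C

text \<open>
  The pairs \<open>(D i, j)\<close> and \<open>(C, j)\<close> stand for the basis vectors \<open>d_i \<otimes> t^j\<close> and \<open>c \<otimes> t^j\<close>
  of \<open>Vir \<otimes> \<complex>[t, t^-1]\<close>; an element of the algebra is a finitely supported family of
  coordinates.
\<close>

type_synonym loop_basis = "vir_basis \<times> int"
type_synonym loop_vir = "loop_basis \<Rightarrow>\<^sub>0 complex"

definition loop_scale :: "complex \<Rightarrow> loop_vir \<Rightarrow> loop_vir"
  where "loop_scale a x = Poly_Mapping.map ((*) a) x"

fun basis_bracket :: "loop_basis \<Rightarrow> loop_basis \<Rightarrow> loop_vir"
  where
    "basis_bracket (D i, j) (D k, l) =
       Poly_Mapping.single (D (i + k), j + l) (of_int (k - i)) +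
       (if i + k = 0 then Poly_Mapping.single (C, j + l) (of_int (i ^ 3 - i) / 12) else 0)"
  | "basis_bracket (C, j) b = 0"
  | "basis_bracket (D i, j) (C, l) = 0"

definition bracket :: "loop_vir \<Rightarrow> loop_vir \<Rightarrow> loop_vir"
  where "bracket x y =
    (\<Sum>a\<in>Poly_Mapping.keys x. \<Sum>b\<in>Poly_Mapping.keys y.
       loop_scale (Poly_Mapping.lookup x a * Poly_Mapping.lookup y b) (basis_bracket a b))"

definition d0 :: loop_vir
  where "d0 = Poly_Mapping.single (D 0, 0) 1"

fun vir_degree :: "loop_basis \<Rightarrow> int"
  where
    "vir_degree (D i, j) = i"
  | "vir_degree (C, j) = 0"

definition loop_graded :: "int set \<Rightarrow> loop_vir set"
  where "loop_graded S = {x. vir_degree ` Poly_Mapping.keys x \<subseteq> S}"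

abbreviation loop_zero :: "loop_vir set"
  where "loop_zero \<equiv> loop_graded {0}"

abbreviation loop_plus :: "loop_vir set"
  where "loop_plus \<equiv> loop_graded {0<..}"

abbreviation loop_minus :: "loop_vir set"
  where "loop_minus \<equiv> loop_graded {..<0}"


subsection \<open>Modules over the loop-Virasoro algebra\<close>

locale loop_vir_module = vector_space scale
  for scale :: "complex \<Rightarrow> 'v::ab_group_add \<Rightarrow> 'v" +
  fixes act :: "loop_vir \<Rightarrow> 'v \<Rightarrow> 'v"
  assumes act_add: "act (x + y) v = act x v + act y v"
    and act_scale: "act (loop_scale a x) v = scale a (act x v)"
    and act_add_right: "act x (v + w) = act x v + act x w"
    and act_scale_right: "act x (scale a v) = scale a (act x v)"
    and act_bracket: "act (bracket x y) v = act x (act y v) - act y (act x v)"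

text \<open>
  The highest weight modules below depend on a linear form and hence cannot live on a type of
  their own.  They are carried by sets; their additive group is a multiplicatively written
  \<^typ>\<open>'v monoid\<close>.
\<close>

record 'v lmod = "'v monoid" +
  scal :: "complex \<Rightarrow> 'v \<Rightarrow> 'v"
  lact :: "loop_vir \<Rightarrow> 'v \<Rightarrow> 'v"

definition lmod_of :: "(complex \<Rightarrow> 'v::ab_group_add \<Rightarrow> 'v) \<Rightarrow> (loop_vir \<Rightarrow> 'v \<Rightarrow> 'v) \<Rightarrow> 'v lmod"
  where "lmod_of scale act =
    \<lparr>carrier = UNIV, monoid.mult = (+), one = 0, scal = scale, lact = act\<rparr>"

definition lsubmodule :: "'v set \<Rightarrow> 'v lmod \<Rightarrow> bool"
  where "lsubmodule N M \<longleftrightarrow> subgroup N M \<and>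
    (\<forall>v\<in>N. (\<forall>a. scal M a v \<in> N) \<and> (\<forall>x. lact M x v \<in> N))"

definition maximal_proper_lsubmodule :: "'v set \<Rightarrow> 'v lmod \<Rightarrow> bool"
  where "maximal_proper_lsubmodule N M \<longleftrightarrow> lsubmodule N M \<and> N \<noteq> carrier M \<and>
    (\<forall>N'. lsubmodule N' M \<and> N \<subseteq> N' \<longrightarrow> N' = N \<or> N' = carrier M)"

definition irreducible_lmod :: "'v lmod \<Rightarrow> bool"
  where "irreducible_lmod M \<longleftrightarrow> carrier M \<noteq> {\<one>\<^bsub>M\<^esub>} \<and>
    (\<forall>N. lsubmodule N M \<longrightarrow> N = {\<one>\<^bsub>M\<^esub>} \<or> N = carrier M)"

text \<open>The map that an endomorphism \<open>f\<close> preserving \<open>N\<close> induces on the cosets of \<open>N\<close>.\<close>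

definition coset_map :: "('a, 'b) monoid_scheme \<Rightarrow> 'a set \<Rightarrow> ('a \<Rightarrow> 'a) \<Rightarrow> 'a set \<Rightarrow> 'a set"
  where "coset_map G N f X = N <#>\<^bsub>G\<^esub> (f ` X)"

definition lmod_quotient :: "'v lmod \<Rightarrow> 'v set \<Rightarrow> 'v set lmod"
  where "lmod_quotient M N =
    monoid.extend (M Mod N)
      \<lparr>scal = (\<lambda>a. coset_map M N (scal M a)), lact = (\<lambda>x. coset_map M N (lact M x))\<rparr>"

definition lmod_isomorphic :: "'v lmod \<Rightarrow> 'w lmod \<Rightarrow> bool"
  where "lmod_isomorphic M M' \<longleftrightarrow>
    (\<exists>f\<in>iso M M'. \<forall>v\<in>carrier M.
       (\<forall>a. f (scal M a v) = scal M' a (f v)) \<and> (\<forall>x. f (lact M x v) = lact M' x (f v)))"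


subsection \<open>The universal enveloping algebra\<close>

text \<open>
  The tensor algebra of the loop-Virasoro algebra is the free associative algebra on its basis,
  i.e. the monoid algebra of the words in that basis.  A word is wrapped in a constructor so that
  concatenation can be written additively, as the product on \<open>\<Rightarrow>\<^sub>0\<close> requires.
\<close>

datatype word = Word (letters: "loop_basis list")

instantiation word :: monoid_add
begin
definition "0 = Word []"
definition "v + w = Word (letters v @ letters w)"
instance
  by standard (simp_all add: zero_word_def plus_word_def)
end

type_synonym tensor_alg = "word \<Rightarrow>\<^sub>0 complex"

definition tensor_of :: "loop_vir \<Rightarrow> tensor_alg"
  where "tensor_of x =
    (\<Sum>b\<in>Poly_Mapping.keys x. Poly_Mapping.single (Word [b]) (Poly_Mapping.lookup x b))"

inductive_set uea_ideal :: "tensor_alg set"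
  where
    zero: "0 \<in> uea_ideal"
  | relation: "tensor_of x * tensor_of y - tensor_of y * tensor_of x - tensor_of (bracket x y)
      \<in> uea_ideal"
  | add: "p \<in> uea_ideal \<Longrightarrow> q \<in> uea_ideal \<Longrightarrow> p + q \<in> uea_ideal"
  | mult_left: "p \<in> uea_ideal \<Longrightarrow> r * p \<in> uea_ideal"
  | mult_right: "p \<in> uea_ideal \<Longrightarrow> p * r \<in> uea_ideal"

lemma uea_ideal_uminus: "p \<in> uea_ideal \<Longrightarrow> - p \<in> uea_ideal"
  using uea_ideal.mult_left[of p "- 1"] by simp

lemma uea_ideal_minus: "p \<in> uea_ideal \<Longrightarrow> q \<in> uea_ideal \<Longrightarrow> p - q \<in> uea_ideal"
  using uea_ideal.add[of p "- q"] uea_ideal_uminus by simp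

definition uea_rel :: "tensor_alg \<Rightarrow> tensor_alg \<Rightarrow> bool"
  where "uea_rel p q \<longleftrightarrow> p - q \<in> uea_ideal"

lemma equivp_uea_rel: "equivp uea_rel"
proof (rule equivpI)
  show "reflp uea_rel"
    by (simp add: reflp_def uea_rel_def uea_ideal.zero)
  show "symp uea_rel"
  proof (rule sympI)
    fix p q assume "uea_rel p q"
    then show "uea_rel q p"
      using uea_ideal_uminus[of "p - q"] by (simp add: uea_rel_def)
  qed
  show "transp uea_rel"
  proof (rule transpI)
    fix p q r assume "uea_rel p q" "uea_rel q r"
    then show "uea_rel p r"
      using uea_ideal.add[of "p - q" "q - r"] by (simp add: uea_rel_def)
  qed
qed

quotient_type uea = tensor_alg / uea_rel
  by (rule equivp_uea_rel)

lemma lookup_times_empty_word: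
  "Poly_Mapping.lookup (p * q) (0::word) = Poly_Mapping.lookup p 0 * Poly_Mapping.lookup q 0"
  for p q :: tensor_alg
proof -
  have split: "0 = k + l \<longleftrightarrow> k = 0 \<and> l = 0" for k l :: word
    by (cases k; cases l) (auto simp: zero_word_def plus_word_def)
  have *: "(\<Sum>l. Poly_Mapping.lookup q l when 0 = k + l) = (Poly_Mapping.lookup q 0 when k = 0)"
    for k :: word
    by (simp add: split conj_commute flip: when_when) (simp add: when_def)
  show ?thesis
    unfolding times_poly_mapping.rep_eq prod_fun_def * by (simp add: mult_when)
qed

lemma uea_ideal_lookup_empty_word: "p \<in> uea_ideal \<Longrightarrow> Poly_Mapping.lookup p 0 = 0"
proof (induction rule: uea_ideal.induct)
  case (relation x y)
  have "Poly_Mapping.lookup (tensor_of z) 0 = 0" for z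
    by (simp add: tensor_of_def lookup_sum lookup_single zero_word_def)
  then show ?case
    by (simp add: lookup_minus lookup_times_empty_word)
qed (simp_all add: lookup_add lookup_times_empty_word)

instantiation uea :: ring_1
begin

lift_definition zero_uea :: uea is 0 .

lift_definition one_uea :: uea is 1 .

lift_definition plus_uea :: "uea \<Rightarrow> uea \<Rightarrow> uea" is "(+)"
proof -
  fix p p' q q' assume "uea_rel p p'" "uea_rel q q'"
  moreover have "p + q - (p' + q') = (p - p') + (q - q')"
    by simp
  ultimately show "uea_rel (p + q) (p' + q')"
    by (simp only: uea_rel_def uea_ideal.add)
qed

lift_definition uminus_uea :: "uea \<Rightarrow> uea" is uminus
proof -
  fix p p' assume "uea_rel p p'"
  moreover have "- p - - p' = - (p - p')"
    by simp
  ultimately show "uea_rel (- p) (- p')"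
    by (simp only: uea_rel_def uea_ideal_uminus)
qed

lift_definition minus_uea :: "uea \<Rightarrow> uea \<Rightarrow> uea" is "(-)"
proof -
  fix p p' q q' assume "uea_rel p p'" "uea_rel q q'"
  moreover have "p - q - (p' - q') = (p - p') - (q - q')"
    by simp
  ultimately show "uea_rel (p - q) (p' - q')"
    by (simp only: uea_rel_def uea_ideal_minus)
qed

lift_definition times_uea :: "uea \<Rightarrow> uea \<Rightarrow> uea" is "(*)"
proof -
  fix p p' q q' assume "uea_rel p p'" "uea_rel q q'"
  moreover have "p * q - p' * q' = (p - p') * q + p' * (q - q')"
    by (simp add: algebra_simps)
  ultimately show "uea_rel (p * q) (p' * q')"
    by (simp add: uea_rel_def uea_ideal.intros)
qed

instance
proof
  have "\<not> uea_rel 0 1"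
    using uea_ideal_lookup_empty_word[of "0 - 1"] by (auto simp: uea_rel_def lookup_minus lookup_one)
  then show "(0::uea) \<noteq> 1"
    by transfer
qed (transfer; simp add: algebra_simps uea_rel_def uea_ideal.zero)+

end

lift_definition uea_of :: "loop_vir \<Rightarrow> uea" is tensor_of .

lift_definition uea_scalar :: "complex \<Rightarrow> uea" is "Poly_Mapping.single 0" .


subsection \<open>Highest and lowest weight modules\<close>

definition linear_form_on :: "loop_vir set \<Rightarrow> (loop_vir \<Rightarrow> complex) \<Rightarrow> bool"
  where "linear_form_on S \<phi> \<longleftrightarrow>
    (\<forall>x\<in>S. \<forall>y\<in>S. \<phi> (x + y) = \<phi> x + \<phi> y) \<and> (\<forall>a. \<forall>x\<in>S. \<phi> (loop_scale a x) = a * \<phi> x)"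

text \<open>
  In what follows \<open>P\<close> is \<^term>\<open>loop_plus\<close> or \<^term>\<open>loop_minus\<close>.  The relation
  \<open>acts_on_v0 P \<phi> r a\<close> says that \<open>r\<close> lies in the enveloping algebra of \<open>loop_zero + P\<close>, regarded as
  a subalgebra of \<^typ>\<open>uea\<close>, and acts on the one-dimensional module \<open>\<complex> v_0\<close> as the scalar \<open>a\<close>.
\<close>

inductive acts_on_v0 :: "loop_vir set \<Rightarrow> (loop_vir \<Rightarrow> complex) \<Rightarrow> uea \<Rightarrow> complex \<Rightarrow> bool"
  for P \<phi>
  where
    lie: "x \<in> loop_zero \<Longrightarrow> y \<in> P \<Longrightarrow> acts_on_v0 P \<phi> (uea_of (x + y)) (\<phi> x)"
  | scalar: "acts_on_v0 P \<phi> (uea_scalar a) a"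
  | add: "acts_on_v0 P \<phi> r a \<Longrightarrow> acts_on_v0 P \<phi> s b \<Longrightarrow> acts_on_v0 P \<phi> (r + s) (a + b)"
  | mult: "acts_on_v0 P \<phi> r a \<Longrightarrow> acts_on_v0 P \<phi> s b \<Longrightarrow> acts_on_v0 P \<phi> (r * s) (a * b)"

text \<open>
  The tensor product of \<^typ>\<open>uea\<close> and \<open>\<complex> v_0\<close> over the enveloping algebra of \<open>loop_zero + P\<close>:
  the free abelian group on the pairs \<open>(u, z)\<close>, which stand for \<open>u \<otimes> z v_0\<close>, modulo biadditivity
  and balancedness.
\<close>

abbreviation pair_group :: "(uea \<times> complex \<Rightarrow>\<^sub>0 int) monoid"
  where "pair_group \<equiv> free_Abelian_group UNIV"

definition tensor_relations ::
    "loop_vir set \<Rightarrow> (loop_vir \<Rightarrow> complex) \<Rightarrow> (uea \<times> complex \<Rightarrow>\<^sub>0 int) set"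
  where "tensor_relations P \<phi> = generate pair_group
    ({frag_of (u + u', z) - frag_of (u, z) - frag_of (u', z) | u u' z. True} \<union>
     {frag_of (u, z + z') - frag_of (u, z) - frag_of (u, z') | u z z'. True} \<union>
     {frag_of (u * r, z) - frag_of (u, a * z) | u r a z. acts_on_v0 P \<phi> r a})"

definition pair_mult :: "uea \<Rightarrow> (uea \<times> complex \<Rightarrow>\<^sub>0 int) \<Rightarrow> (uea \<times> complex \<Rightarrow>\<^sub>0 int)"
  where "pair_mult w = frag_extend (\<lambda>(u, z). frag_of (w * u, z))"

definition induced_module ::
    "loop_vir set \<Rightarrow> (loop_vir \<Rightarrow> complex) \<Rightarrow> (uea \<times> complex \<Rightarrow>\<^sub>0 int) set lmod"
  where "induced_module P \<phi> =
    monoid.extend (pair_group Mod tensor_relations P \<phi>)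
      \<lparr>scal = (\<lambda>a. coset_map pair_group (tensor_relations P \<phi>) (pair_mult (uea_scalar a))),
       lact = (\<lambda>x. coset_map pair_group (tensor_relations P \<phi>) (pair_mult (uea_of x)))\<rparr>"

definition irreducible_quotient ::
    "loop_vir set \<Rightarrow> (loop_vir \<Rightarrow> complex) \<Rightarrow> (uea \<times> complex \<Rightarrow>\<^sub>0 int) set set lmod"
  where "irreducible_quotient P \<phi> =
    lmod_quotient (induced_module P \<phi>)
      (THE N. maximal_proper_lsubmodule N (induced_module P \<phi>))"

definition extremal_weight_module ::
    "loop_vir set \<Rightarrow> (complex \<Rightarrow> 'v::ab_group_add \<Rightarrow> 'v) \<Rightarrow> (loop_vir \<Rightarrow> 'v \<Rightarrow> 'v) \<Rightarrow> bool"
  where "extremal_weight_module P scale act \<longleftrightarrow>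
    loop_vir_module scale act \<and> irreducible_lmod (lmod_of scale act) \<and>
    (\<exists>\<phi>. linear_form_on loop_zero \<phi> \<and>
       lmod_isomorphic (lmod_of scale act) (irreducible_quotient P \<phi>))"

definition highest_weight_module ::
    "(complex \<Rightarrow> 'v::ab_group_add \<Rightarrow> 'v) \<Rightarrow> (loop_vir \<Rightarrow> 'v \<Rightarrow> 'v) \<Rightarrow> bool"
  where "highest_weight_module = extremal_weight_module loop_plus"

definition lowest_weight_module ::
    "(complex \<Rightarrow> 'v::ab_group_add \<Rightarrow> 'v) \<Rightarrow> (loop_vir \<Rightarrow> 'v \<Rightarrow> 'v) \<Rightarrow> bool"
  where "lowest_weight_module = extremal_weight_module loop_minus"


subsection \<open>Weight modules\<close>

context loop_vir_module
begin

definition weight_space :: "complex \<Rightarrow> 'v set"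
  where "weight_space \<mu> = {v. act d0 v = scale \<mu> v}"

definition weight_module :: bool
  where "weight_module \<longleftrightarrow> span (\<Union>\<mu>. weight_space \<mu>) = UNIV"

text \<open>
  Finite-dimensionality has to be required explicitly, since \<open>dim\<close> is \<open>0\<close> for
  infinite-dimensional subspaces.
\<close>

definition finite_dim :: "'v set \<Rightarrow> bool"
  where "finite_dim W \<longleftrightarrow> (\<exists>B. finite B \<and> span B = W)"

definition harish_chandra_module :: bool
  where "harish_chandra_module \<longleftrightarrow> weight_module \<and> (\<forall>\<mu>. finite_dim (weight_space \<mu>))"

definition uniformly_bounded_module :: bool
  where "uniformly_bounded_module \<longleftrightarrow> weight_module \<and>
    (\<exists>N::nat. \<forall>\<mu>. weight_space \<mu> \<noteq> {0} \<longrightarrow>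
       finite_dim (weight_space \<mu>) \<and> dim (weight_space \<mu>) < N)"

end

end

(*
  Suppose that no non-zero weight vector is annihilated by all positive degrees, nor by all negative
  degrees.  For a weight space V_x and k ~= 0, the operators d_k t^j (j in Z) span a finite-dimensional
  space of maps on V_x, and commuting with d_0 t^l shows that the f with d_k f C[t,1/t] V_x = 0 include a
  non-zero polynomial; hence one p serves finitely many pairs (x, k).  If d_k p t^j maps v in V_x to w,
  then d_-1 t^l w and d_-2 t^l w only involve d_k p on V_(x-1), V_(x-2) and d_(k-1) p, d_(k-2) p on V_x, so
  that w = 0 by assumption whenever these four vanish.  Starting from finitely many pairs this yields
  d_k p t^j V_x = 0 for all k > 0, and by symmetry for all k < 0.  The vectors annihilated by all of
  Vir (x) p C[t,1/t] form a submodule, so V is a module over Vir (x) C[t,1/t]/(p).  Now d_i t^j and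
  d_(i+1) t^j with 0 <= j < deg p map V_(x-i) to V_x + V_(x+1); a common kernel vector would be annihilated
  by all large degrees, which forces a vector annihilated by all positive degrees.  So
  dim V_(x-i) <= 2 deg p (dim V_x + dim V_(x+1)), and symmetrically on the other side.

  If conversely a weight vector v is annihilated by the positive degrees, it can be chosen as an
  eigenvector of the commutative algebra L_0.  The induced module is U / I for a left ideal I, and
  U = C + (words in L_-) + I; a polynomial in d_0 separates the weight of v from the lower ones, so that
  every submodule of U / I outside of the kernel of U / I -> V contains the generator.
*)
theory Submission
  imports Defs "HOL-Computational_Algebra.Fundamental_Theorem_Algebra" "HOL-Library.Function_Algebras"
begin


subsection \<open>Linear algebra over the complex numbers\<close>

locale complex_space = vector_space scale
  for scale :: "complex \<Rightarrow> 'v::ab_group_add \<Rightarrow> 'v"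
begin

abbreviation lin :: "('v \<Rightarrow> 'v) \<Rightarrow> bool"
  where "lin T \<equiv> Vector_Spaces.linear scale scale T"

lemma linI:
  assumes "\<And>x y. T (x + y) = T x + T y" "\<And>a x. T (scale a x) = scale a (T x)"
  shows "lin T"
  using assms by unfold_locales

lemma lin_add: "lin T \<Longrightarrow> T (x + y) = T x + T y"
  by (rule Vector_Spaces.linear.axioms(3)[THEN module_hom.add])

lemma lin_scale: "lin T \<Longrightarrow> T (scale a x) = scale a (T x)"
  by (rule Vector_Spaces.linear.axioms(3)[THEN module_hom.scale])

lemma lin_zero: "lin T \<Longrightarrow> T 0 = 0"
  using lin_scale[of T 0 0] by simp

lemma lin_minus: "lin T \<Longrightarrow> T (x - y) = T x - T y"
  using lin_add[of T "x - y" y] by simp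

lemma lin_uminus: "lin T \<Longrightarrow> T (- x) = - T x"
  using lin_minus[of T 0 x] lin_zero[of T] by simp

lemma lin_sum: "lin T \<Longrightarrow> T (sum f A) = (\<Sum>a\<in>A. T (f a))"
  by (induction A rule: infinite_finite_induct) (simp_all add: lin_zero lin_add)

lemma lin_funpow: "lin T \<Longrightarrow> lin (T ^^ n)"
  by (induction n) (auto intro!: linI simp: lin_add lin_scale)

text \<open>The pairing of a polynomial with a sequence of vectors. For
  \<open>y i = (T ^^ i) v\<close> it is p(T) v; for \<open>y s = D k (j + int s) v\<close> it is the
  action of d_k \<otimes> p(t) t^j.\<close>

definition poly_comb :: "complex poly \<Rightarrow> (nat \<Rightarrow> 'v) \<Rightarrow> 'v"
  where "poly_comb p y = (\<Sum>i\<le>degree p. scale (poly.coeff p i) (y i))"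

lemma poly_comb_bound:
  assumes "degree p \<le> n"
  shows "poly_comb p y = (\<Sum>i\<le>n. scale (poly.coeff p i) (y i))"
  unfolding poly_comb_def
  by (rule sum.mono_neutral_left) (use assms in \<open>auto simp: coeff_eq_0\<close>)

lemma poly_comb_0 [simp]: "poly_comb 0 y = 0"
  by (simp add: poly_comb_def)

lemma poly_comb_pCons: "poly_comb (pCons a p) y = scale a (y 0) + poly_comb p (\<lambda>i. y (Suc i))"
proof -
  have "poly_comb (pCons a p) y = (\<Sum>i\<le>Suc (degree p). scale (poly.coeff (pCons a p) i) (y i))"
    by (rule poly_comb_bound) (rule degree_pCons_le)
  also have "\<dots> = scale a (y 0) + poly_comb p (\<lambda>i. y (Suc i))"
    by (simp only: sum.atMost_Suc_shift poly_comb_def coeff_pCons_0 coeff_pCons_Suc)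
  finally show ?thesis .
qed

lemma poly_comb_add: "poly_comb (p + q) y = poly_comb p y + poly_comb q y"
proof -
  define n where "n = max (degree p) (degree q)"
  have "degree (p + q) \<le> n" "degree p \<le> n" "degree q \<le> n"
    by (auto simp: n_def degree_add_le_max)
  then show ?thesis
    by (simp add: poly_comb_bound scale_left_distrib sum.distrib)
qed

lemma poly_comb_smult: "poly_comb (smult a p) y = scale a (poly_comb p y)"
  by (simp add: poly_comb_bound[OF degree_smult_le] poly_comb_def scale_sum_right)

text \<open>Multiplication by X corresponds to shifting the sequence, so a product acts by
  successive combinations of shifted sequences.\<close>

lemma poly_comb_mult: "poly_comb (p * q) y = poly_comb p (\<lambda>i. poly_comb q (\<lambda>j. y (i + j)))"
proof (induction p arbitrary: y)
  case (pCons a p)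
  then show ?case
    by (simp add: poly_comb_add poly_comb_smult poly_comb_pCons)
qed simp

lemma poly_comb_vec_add: "poly_comb p (\<lambda>i. y i + z i) = poly_comb p y + poly_comb p z"
  by (simp add: poly_comb_def scale_right_distrib sum.distrib)

lemma poly_comb_vec_scale: "poly_comb p (\<lambda>i. scale a (y i)) = scale a (poly_comb p y)"
  by (simp add: poly_comb_def scale_sum_right mult.commute)

lemma poly_comb_vec_0 [simp]: "poly_comb p (\<lambda>i. 0) = 0"
  by (simp add: poly_comb_def)

lemma poly_comb_cong: "(\<And>i. y i = z i) \<Longrightarrow> poly_comb p y = poly_comb p z"
  by (simp add: poly_comb_def)

lemma lin_poly_comb: "lin T \<Longrightarrow> T (poly_comb p y) = poly_comb p (\<lambda>i. T (y i))"
  by (simp add: poly_comb_def lin_sum lin_scale)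

lemma poly_comb_mem: "subspace U \<Longrightarrow> (\<And>i. y i \<in> U) \<Longrightarrow> poly_comb p y \<in> U"
  unfolding poly_comb_def by (blast intro: subspace_sum subspace_scale)

lemma poly_comb_powers: "poly_comb p (\<lambda>i. scale (a ^ i) v) = scale (poly p a) v"
  by (simp add: poly_comb_def poly_altdef scale_sum_left)

lemma poly_relation:
  fixes u :: "nat \<Rightarrow> 'v"
  assumes "finite B" "range u \<subseteq> span B"
  shows "\<exists>p. p \<noteq> 0 \<and> poly_comb p u = 0"
\<comment> \<open>A repeated value gives the relation X^a - X^b. Otherwise the range is infinite,
  hence dependent, and injectivity turns coefficients of vectors into coefficients of
  indices.\<close>
proof (cases "inj u")
  case False
  then obtain a b where ab: "u a = u b" "a \<noteq> b"
    by (auto simp: inj_def)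
  let ?p = "monom 1 a - monom (1::complex) b"
  have mon: "poly_comb (monom c n) u = scale c (u n)" for c n
    by (induction n arbitrary: u)
      (simp_all add: monom_0 monom_Suc poly_comb_pCons)
  have "poly_comb ?p u = poly_comb (monom 1 a) u + poly_comb (smult (- 1) (monom 1 b)) u"
    by (subst poly_comb_add[symmetric]) simp
  also have "\<dots> = 0"
    using ab by (simp only: poly_comb_smult mon) simp
  finally have "poly_comb ?p u = 0" .
  moreover have "poly.coeff ?p a \<noteq> 0"
    using ab by simp
  then have "?p \<noteq> 0"
    by force
  ultimately show ?thesis by blast
next
  case True
  then have "infinite (range u)"
    by (simp add: finite_image_iff)
  then have "dependent (range u)"
    using independent_span_bound[OF assms(1) _ assms(2)] by blast
  then obtain S c x where S: "finite S" "S \<subseteq> range u" "(\<Sum>v\<in>S. scale (c v) v) = 0" "x \<in> S" "c x \<noteq> 0"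
    unfolding dependent_explicit by blast
  define I where "I = u -` S"
  have I: "finite I" "u ` I = S"
    using S True by (auto simp: I_def finite_vimageI)
  then obtain n where n: "I \<subseteq> {..n}"
    using finite_nat_iff_bounded_le by blast
  define p where "p = (\<Sum>i\<in>I. monom (c (u i)) i)"
  have cf: "poly.coeff p i = (if i \<in> I then c (u i) else 0)" for i
    using I by (simp add: p_def coeff_sum sum.delta')
  have "degree p \<le> n"
    using n by (intro degree_le) (auto simp: cf)
  then have "poly_comb p u = (\<Sum>i\<le>n. scale (poly.coeff p i) (u i))"
    by (rule poly_comb_bound)
  also have "\<dots> = (\<Sum>i\<in>I. scale (c (u i)) (u i))"
    using n by (intro sum.mono_neutral_cong_right) (auto simp: cf)
  also have "\<dots> = (\<Sum>v\<in>S. scale (c v) v)"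
    using sum.reindex[OF inj_on_subset[OF True, of I], of "\<lambda>v. scale (c v) v"] I by simp
  finally have "poly_comb p u = 0"
    using S by simp
  moreover obtain i where "i \<in> I" "x = u i"
    using S I by blast
  then have "poly.coeff p i \<noteq> 0"
    using S by (simp add: cf)
  then have "p \<noteq> 0"
    by force
  ultimately show ?thesis by blast
qed

section \<open>Finite-dimensional subspaces and common eigenvectors\<close>

lemma subspace_basis:
  assumes "subspace U" "finite B" "U \<subseteq> span B"
  obtains B' where "finite B'" "independent B'" "span B' = U" "card B' = dim U" "card B' \<le> card B"
proof -
  obtain B' where B': "B' \<subseteq> U" "independent B'" "U \<subseteq> span B'" "card B' = dim U"
    using basis_exists by blast
  moreover have "finite B'" "card B' \<le> card B"
    using independent_span_bound[OF assms(2) B'(2)] B'(1) assms(3) by blast+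
  moreover have "span B' \<subseteq> U"
    using B' assms(1) by (simp add: span_minimal)
  ultimately show ?thesis
    using that by (metis subset_antisym)
qed

text \<open>
  A minimal polynomial relation among \<open>w, T w, T\<^sup>2 w, \<dots>\<close> with \<open>w\<close> ranging over
  \<open>U\<close> has degree one, since the fundamental theorem of algebra splits off a linear factor.
\<close>

lemma eigenvector_exists:
  assumes T: "lin T" and U: "subspace U" "finite B" "U \<subseteq> span B" "T ` U \<subseteq> U" and "U \<noteq> {0}"
  shows "\<exists>v a. v \<in> U \<and> v \<noteq> 0 \<and> T v = scale a v"
proof -
  define Q where "Q n \<longleftrightarrow> (\<exists>p w. degree p = n \<and> p \<noteq> 0 \<and> w \<in> U \<and> w \<noteq> 0 \<and> poly_comb p (\<lambda>i. (T ^^ i) w) = 0)"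
    for n
  obtain w0 where w0: "w0 \<in> U" "w0 \<noteq> 0"
    using \<open>U \<noteq> {0}\<close> U(1) subspace_0 by blast
  have powU: "(T ^^ i) w \<in> U" if "w \<in> U" for i w
    using that U(4) by (induction i) auto
  then have "range (\<lambda>i. (T ^^ i) w0) \<subseteq> span B"
    using U(3) w0 by blast
  from poly_relation[OF U(2) this] w0 have "\<exists>n. Q n"
    unfolding Q_def by blast
  then obtain n where n: "Q n" "\<And>m. m < n \<Longrightarrow> \<not> Q m"
    by (metis exists_least_iff)
  then obtain p w where p: "degree p = n" "p \<noteq> 0" "w \<in> U" "w \<noteq> 0" "poly_comb p (\<lambda>i. (T ^^ i) w) = 0"
    unfolding Q_def by blast
  have "degree p \<noteq> 0"
  proof
    assume "degree p = 0"
    then obtain c where "p = [:c:]"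
      by (rule degree_eq_zeroE)
    then show False
      using p by (simp add: poly_comb_pCons)
  qed
  then obtain a where "poly p a = 0"
    using fundamental_theorem_of_algebra[of p] by (auto simp: constant_degree)
  then obtain q where q: "p = [:- a, 1:] * q"
    by (auto simp: poly_eq_0_iff_dvd)
  with \<open>p \<noteq> 0\<close> have "q \<noteq> 0"
    by auto
  then have dp: "degree p = Suc (degree q)"
    by (simp add: q degree_mult_eq del: mult_pCons_left)
  define v where "v = poly_comb q (\<lambda>i. (T ^^ i) w)"
  have "v \<noteq> 0"
    using n(2)[of "degree q"] p \<open>q \<noteq> 0\<close> dp unfolding Q_def v_def by auto
  moreover have "v \<in> U"
    unfolding v_def using U(1) powU p by (blast intro: poly_comb_mem)
  \<comment> \<open>Applying \<open>T\<close> shifts the sequence of powers, so the left-hand side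
    is (T - a) q(T) w = p(T) w.\<close>
  moreover have "T v - scale a v = poly_comb p (\<lambda>i. (T ^^ i) w)"
    by (simp add: q poly_comb_mult poly_comb_pCons v_def lin_poly_comb[OF T] del: mult_pCons_left)
  then have "T v = scale a v"
    using p by simp
  ultimately show ?thesis by blast
qed

text \<open>In a non-zero invariant subspace of least dimension every operator of the family has an
  eigenspace, which is invariant by commutativity and therefore the whole subspace. The family may
  be infinite.\<close>

lemma common_eigenvector_exists:
  assumes lin: "\<And>T. T \<in> \<T> \<Longrightarrow> lin T"
    and comm: "\<And>S T v. S \<in> \<T> \<Longrightarrow> T \<in> \<T> \<Longrightarrow> S (T v) = T (S v)"
    and U: "subspace U" "finite B" "U \<subseteq> span B" "\<And>T. T \<in> \<T> \<Longrightarrow> T ` U \<subseteq> U" and "U \<noteq> {0}"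
  shows "\<exists>v\<in>U. v \<noteq> 0 \<and> (\<forall>T\<in>\<T>. \<exists>a. T v = scale a v)"
proof -
  define Q where "Q n \<longleftrightarrow> (\<exists>W. subspace W \<and> W \<subseteq> U \<and> W \<noteq> {0} \<and> (\<forall>T\<in>\<T>. T ` W \<subseteq> W) \<and> dim W = n)"
    for n
  have "\<exists>n. Q n"
    unfolding Q_def using assms by blast
  then obtain n where n: "Q n" "\<And>m. m < n \<Longrightarrow> \<not> Q m"
    by (metis exists_least_iff)
  then obtain W where W: "subspace W" "W \<subseteq> U" "W \<noteq> {0}" "\<And>T. T \<in> \<T> \<Longrightarrow> T ` W \<subseteq> W" "dim W = n"
    unfolding Q_def by blast
  have WB: "W \<subseteq> span B"
    using W U by blast
  obtain BW where BW: "finite BW" "independent BW" "span BW = W" "card BW = dim W"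
    using subspace_basis[OF W(1) U(2) WB] by blast
  have scalar: "\<exists>a. \<forall>w\<in>W. T w = scale a w" if T: "T \<in> \<T>" for T
  proof -
    obtain v a where v: "v \<in> W" "v \<noteq> 0" "T v = scale a v"
      using eigenvector_exists[OF lin[OF T] W(1) U(2) WB W(4)[OF T] W(3)] by blast
    define E where "E = {w\<in>W. T w = scale a w}"
    have E: "subspace E"
      using W(1) lin[OF T]
      by (auto simp: E_def subspace_def lin_zero lin_add lin_scale scale_right_distrib mult.commute)
    have "S w \<in> E" if "S \<in> \<T>" "w \<in> E" for S w
      using that T W(4)[of S] comm[of S T w]
      by (auto simp: E_def lin_scale[OF lin])
    moreover have "E \<noteq> {0}"
      using v by (auto simp: E_def)
    moreover have "E \<subseteq> W"
      by (auto simp: E_def)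
    ultimately have "Q (dim E)"
      unfolding Q_def using E W(2) by blast
    then have "n \<le> dim E"
      using n(2) by (meson not_le_imp_less)
    obtain BE where BE: "finite BE" "independent BE" "span BE = E" "card BE = dim E"
      using subspace_basis[OF E U(2)] \<open>E \<subseteq> W\<close> WB by blast
    have "W \<subseteq> E"
    proof
      fix w assume "w \<in> W"
      show "w \<in> E"
      proof (rule ccontr)
        assume "w \<notin> E"
        then have "independent (insert w BE)"
          using BE independent_insertI by blast
        moreover have "insert w BE \<subseteq> span BW"
          using BW BE \<open>w \<in> W\<close> \<open>E \<subseteq> W\<close> span_superset by blast
        ultimately have "card (insert w BE) \<le> card BW"
          using independent_span_bound[OF BW(1)] by blast
        moreover have "w \<notin> BE"
          using BE \<open>w \<notin> E\<close> span_superset by blast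
        ultimately show False
          using BE BW W(5) \<open>n \<le> dim E\<close> by simp
      qed
    qed
    then show ?thesis
      by (auto simp: E_def)
  qed
  obtain v where v: "v \<in> W" "v \<noteq> 0"
    using W subspace_0 by blast
  then show ?thesis
    using scalar W(2) by blast
qed

text \<open>Modulo \<open>I\<close>, \<open>u\<close> has no component of eigenvalue \<nu>. The
  relative form serves both \<open>I = {0}\<close> on a module and left ideals of the enveloping
  algebra.\<close>

definition separated_from :: "('v \<Rightarrow> 'v) \<Rightarrow> 'v set \<Rightarrow> complex \<Rightarrow> 'v \<Rightarrow> bool"
  where "separated_from T I \<nu> u \<longleftrightarrow> (\<exists>p. poly p \<nu> \<noteq> 0 \<and> poly_comb p (\<lambda>i. (T ^^ i) u) \<in> I)"

lemma funpow_eigen_mod: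
  assumes "lin T" "subspace I" "T ` I \<subseteq> I" "T u - scale a u \<in> I"
  shows "(T ^^ n) u - scale (a ^ n) u \<in> I"
proof (induction n)
  case (Suc n)
  have "(T ^^ Suc n) u - scale (a ^ Suc n) u =
    T ((T ^^ n) u - scale (a ^ n) u) + scale (a ^ n) (T u - scale a u)"
    using assms(1) by (simp add: lin_minus lin_scale algebra_simps)
  then show ?case
    using Suc assms(2-) by (auto intro!: subspace_add subspace_scale)
qed (use assms subspace_0 in simp)

lemma poly_comb_eigen_mod:
  assumes "lin T" "subspace I" "T ` I \<subseteq> I" "T u - scale a u \<in> I"
  shows "poly_comb p (\<lambda>i. (T ^^ i) u) - scale (poly p a) u \<in> I"
proof -
  have "poly_comb p (\<lambda>i. (T ^^ i) u) - scale (poly p a) u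
    = poly_comb p (\<lambda>i. (T ^^ i) u - scale (a ^ i) u)"
    using poly_comb_vec_add[of p "\<lambda>i. (T ^^ i) u - scale (a ^ i) u" "\<lambda>i. scale (a ^ i) u"]
    by (simp add: poly_comb_powers)
  also have "\<dots> \<in> I"
    using assms(2) by (rule poly_comb_mem) (rule funpow_eigen_mod[OF assms])
  finally show ?thesis .
qed

lemma separated_from_eigen:
  assumes "lin T" "subspace I" "T ` I \<subseteq> I" "T u - scale a u \<in> I" "a \<noteq> \<nu>"
  shows "separated_from T I \<nu> u"
  using poly_comb_eigen_mod[OF assms(1-4), of "[:- a, 1:]"] assms(5)
  unfolding separated_from_def by (intro exI[of _ "[:- a, 1:]"]) simp

lemma separated_from_mem:
  assumes "u \<in> I"
  shows "separated_from T I \<nu> u"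
  using assms unfolding separated_from_def by (intro exI[of _ 1]) (simp add: poly_comb_def)

text \<open>The product of the two polynomials works for both summands and is still non-zero at
  \<nu>.\<close>

lemma separated_from_add:
  assumes T: "lin T" and I: "subspace I" "T ` I \<subseteq> I"
    and "separated_from T I \<nu> u" "separated_from T I \<nu> v"
  shows "separated_from T I \<nu> (u + v)"
proof -
  obtain p q where p: "poly p \<nu> \<noteq> 0" "poly_comb p (\<lambda>i. (T ^^ i) u) \<in> I"
    and q: "poly q \<nu> \<noteq> 0" "poly_comb q (\<lambda>i. (T ^^ i) v) \<in> I"
    using assms unfolding separated_from_def by blast
  have pow: "(T ^^ i) x \<in> I" if "x \<in> I" for i x
    using that I(2) by (induction i) auto
  have prod: "poly_comb (q * p) (\<lambda>i. (T ^^ i) x) \<in> I"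
    if "poly_comb p (\<lambda>i. (T ^^ i) x) \<in> I" for x p q
    using that I(1) pow
    by (auto simp: poly_comb_mult funpow_add lin_poly_comb[OF lin_funpow[OF T], symmetric]
        intro!: poly_comb_mem)
  have "poly_comb (q * p) (\<lambda>i. (T ^^ i) (u + v)) =
    poly_comb (q * p) (\<lambda>i. (T ^^ i) u) + poly_comb (p * q) (\<lambda>i. (T ^^ i) v)"
    using T by (simp add: lin_add[OF lin_funpow] poly_comb_vec_add mult.commute)
  also have "\<dots> \<in> I"
    using I(1) p(2) q(2) by (intro subspace_add prod)
  finally show ?thesis
    unfolding separated_from_def using p(1) q(1) by (intro exI[of _ "q * p"]) simp
qed

end

section \<open>Spaces of vector-valued functions\<close>

lemma complex_space_fun:
  assumes "complex_space scale"
  shows "complex_space (\<lambda>a f i. scale a (f i))"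
proof -
  interpret complex_space scale by fact
  show ?thesis
    by unfold_locales (auto simp: fun_eq_iff scale_right_distrib scale_left_distrib)
qed

definition point_fun :: "'i \<Rightarrow> 'v::zero \<Rightarrow> 'i \<Rightarrow> 'v"
  where "point_fun i v = (\<lambda>j. if j = i then v else 0)"

text \<open>Finitely many vector-valued coordinates are packed into one vector of a function space,
  where \<open>f\<close> is the sum of its one-point parts. The explicit spanning set is finite if
  the \<open>B i\<close> are, and can be counted.\<close>

lemma fun_mem_span_points:
  fixes scale :: "complex \<Rightarrow> 'v::ab_group_add \<Rightarrow> 'v" and f :: "'i \<Rightarrow> 'v"
  assumes "complex_space scale" "finite S"
    and supp: "\<And>i. i \<notin> S \<Longrightarrow> f i = 0"
    and span: "\<And>i. i \<in> S \<Longrightarrow> f i \<in> module.span scale (B i)"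
  shows "f \<in> module.span (\<lambda>a f i. scale a (f i)) (\<Union>i\<in>S. point_fun i ` B i)"
proof -
  interpret complex_space scale by fact
  interpret F: complex_space "\<lambda>a f i. scale a (f i) :: 'v" by (rule complex_space_fun) fact
  let ?X = "\<Union>i\<in>S. point_fun i ` B i"
  have point: "point_fun i v \<in> F.span ?X" if "i \<in> S" "v \<in> span (B i)" for i v
    using that(2)
  proof (induction v rule: span_induct_alt)
    case base
    have "point_fun i (0::'v) = 0"
      by (auto simp: point_fun_def)
    then show ?case
      using F.span_zero by metis
  next
    case (step c x y)
    have eq: "point_fun i (scale c x + y) = (\<lambda>j. scale c (point_fun i x j)) + point_fun i y"
      by (auto simp: point_fun_def fun_eq_iff)
    have "point_fun i x \<in> F.span ?X"
      using step that(1) by (intro F.span_base) blast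
    then show ?case
      unfolding eq using step by (intro F.span_add F.span_scale)
  qed
  have "f = (\<Sum>i\<in>S. point_fun i (f i))"
  proof
    fix j
    have "(\<Sum>i\<in>S. point_fun i (f i)) j = (\<Sum>i\<in>S. point_fun i (f i) j)"
      using \<open>finite S\<close> by induction auto
    also have "\<dots> = f j"
      using supp \<open>finite S\<close> by (simp add: point_fun_def)
    finally show "f j = (\<Sum>i\<in>S. point_fun i (f i)) j" ..
  qed
  also have "\<dots> \<in> F.span ?X"
    using point span by (intro F.span_sum) blast
  finally show ?thesis .
qed

subsection \<open>Operators satisfying the loop-Virasoro relations\<close>

text \<open>\<open>D k j\<close> and \<open>Z j\<close> stand for the actions of d_k \<otimes> t^j
  and c \<otimes> t^j. Only basis vectors are recorded, so that the mirrored operators of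
  \<open>loop_ops_mirror\<close> form another instance on the same space.\<close>

locale loop_ops = complex_space scale
  for scale :: "complex \<Rightarrow> 'v::ab_group_add \<Rightarrow> 'v" +
  fixes D :: "int \<Rightarrow> int \<Rightarrow> 'v \<Rightarrow> 'v" and Z :: "int \<Rightarrow> 'v \<Rightarrow> 'v"
  assumes lin_D: "lin (D k j)"
    and lin_Z: "lin (Z j)"
    and D_D: "D i j (D k l v) = D k l (D i j v) + scale (of_int (k - i)) (D (i + k) (j + l) v) +
      (if i + k = 0 then scale (of_int (i ^ 3 - i) / 12) (Z (j + l) v) else 0)"
    and D_Z: "D k j (Z l v) = Z l (D k j v)"
    and Z_Z: "Z j (Z l v) = Z l (Z j v)"
begin

lemmas D_simps = lin_add[OF lin_D] lin_scale[OF lin_D] lin_zero[OF lin_D] lin_minus[OF lin_D]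
  lin_uminus[OF lin_D]
lemmas Z_simps = lin_add[OF lin_Z] lin_scale[OF lin_Z] lin_zero[OF lin_Z] lin_minus[OF lin_Z]
  lin_uminus[OF lin_Z]

section \<open>Weight spaces\<close>

definition wt :: "complex \<Rightarrow> 'v set"
  where "wt \<mu> = {v. D 0 0 v = scale \<mu> v}"

lemma subspace_wt: "subspace (wt \<mu>)"
  by (auto simp: subspace_def wt_def D_simps scale_right_distrib mult.commute)

lemma zero_wt [simp]: "0 \<in> wt \<mu>"
  by (rule subspace_0[OF subspace_wt])

lemma D_wt:
  assumes "v \<in> wt \<mu>"
  shows "D k j v \<in> wt (\<mu> + of_int k)"
  using assms D_D[of 0 0 k j v] by (simp add: wt_def D_simps scale_left_distrib)

lemma D0_wt: "v \<in> wt \<mu> \<Longrightarrow> D 0 j v \<in> wt \<mu>"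
  using D_wt[of v \<mu> 0 j] by simp

lemma Z_wt: "v \<in> wt \<mu> \<Longrightarrow> Z j v \<in> wt \<mu>"
  by (simp add: wt_def D_Z Z_simps)

text \<open>Vectors of other weights are separated from \<mu> modulo \<open>{0}\<close>, hence so is
  every element of their span; on \<open>wt \<mu>\<close> the separating polynomial acts by its
  non-zero value at \<mu>.\<close>

lemma wt_not_in_other_span:
  assumes "v \<in> span (\<Union>\<nu>\<in>S. wt \<nu>)" "v \<in> wt \<mu>" "\<mu> \<notin> S"
  shows "v = 0"
proof -
  have "separated_from (D 0 0) {0} \<mu> v"
    using assms(1)
  proof (induction v rule: span_induct_alt)
    case base
    show ?case
      by (rule separated_from_mem) simp
  next
    case (step c x y)
    then obtain \<nu> where "\<nu> \<in> S" "x \<in> wt \<nu>"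
      by blast
    then have "separated_from (D 0 0) {0} \<mu> (scale c x)"
      using assms(3) by (intro separated_from_eigen[of _ _ _ \<nu>])
        (auto simp: lin_D lin_zero wt_def D_simps mult.commute)
    then show ?case
      using step by (intro separated_from_add) (auto simp: lin_D lin_zero)
  qed
  then obtain p where p: "poly p \<mu> \<noteq> 0" "poly_comb p (\<lambda>i. (D 0 0 ^^ i) v) = 0"
    unfolding separated_from_def by auto
  have "poly_comb p (\<lambda>i. (D 0 0 ^^ i) v) - scale (poly p \<mu>) v \<in> {0}"
    by (rule poly_comb_eigen_mod) (use assms(2) in \<open>auto simp: lin_D lin_zero wt_def\<close>)
  then show ?thesis
    using p by simp
qed

text \<open>Starting from [d_i, d_(i+1)] = d_(2i+1), brackets with d_i raise n in the degree n i +
  m, and brackets with d_(i+1) raise both n and m, always with positive coefficients. This reaches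
  all degrees with 1 \<le> m < n.\<close>

lemma D_kill_from_two:
  assumes "i \<ge> 1" and k0: "\<And>j. D i j v = 0" "\<And>j. D (i + 1) j v = 0" and k: "k > i * (i + 1)"
  shows "D k j v = 0"
proof -
  have kill: "D (int n * i + m) j v = 0" if "2 \<le> n" "1 \<le> m" "m < int n" for n m j
    using that
  proof (induction n arbitrary: m j rule: nat_induct_at_least)
    case base
    then have "m = 1" by simp
    moreover have "i + (i + 1) \<noteq> 0"
      using assms(1) by simp
    ultimately show ?case
      using D_D[of i 0 "i + 1" j v] k0 by (simp add: D_simps algebra_simps)
  next
    case (Suc n)
    show ?case
    proof (cases "m < int n")
      case True
      let ?k = "int n * i + m"
      have *: "D ?k l v = 0" for l
        using Suc.IH[of m l] Suc.prems True by simp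
      have "int n * i \<ge> 2 * i"
        using Suc.hyps assms(1) by (intro mult_right_mono) auto
      then have "?k - i > 0" "i + ?k \<noteq> 0"
        using Suc.prems assms(1) by linarith+
      then have "D (i + ?k) j v = 0"
        using D_D[of i 0 ?k j v] k0(1) * by (simp add: D_simps del: of_int_diff of_int_add of_int_mult)
      moreover have "i + ?k = int (Suc n) * i + m"
        by (simp add: algebra_simps)
      ultimately show ?thesis
        by simp
    next
      case False
      let ?k = "int n * i + (int n - 1)"
      have *: "D ?k l v = 0" for l
        using Suc.IH[of "int n - 1" l] Suc.hyps by simp
      have "int n * i \<ge> 2 * i"
        using Suc.hyps assms(1) by (intro mult_right_mono) auto
      then have "?k - (i + 1) > 0" "i + 1 + ?k \<noteq> 0"
        using Suc.hyps assms(1) by linarith+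
      then have "D (i + 1 + ?k) j v = 0"
        using D_D[of "i + 1" 0 ?k j v] k0(2) * by (simp add: D_simps del: of_int_diff of_int_add of_int_mult)
      moreover have "m = int n"
        using False Suc.prems by simp
      then have "i + 1 + ?k = int (Suc n) * i + m"
        by (simp add: algebra_simps)
      ultimately show ?thesis
        by simp
    qed
  qed
  \<comment> \<open>The residue is taken in 1..i, as \<open>kill\<close> does not cover m = 0. The
    bound on \<open>k\<close> gives n at least i + 1, hence m < n.\<close>
  let ?n = "(k - 1) div i" and ?m = "(k - 1) mod i + 1"
  have "(i + 1) * i div i \<le> ?n"
    using k assms(1) by (intro zdiv_mono1) (auto simp: algebra_simps)
  then have "i + 1 \<le> ?n"
    using assms(1) by simp
  moreover have "?n * i + ?m = k"
    by simp
  moreover have "1 \<le> ?m" "?m \<le> i"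
    using assms(1) by (auto simp: pos_mod_bound add1_zle_eq)
  ultimately show ?thesis
    using kill[of "nat ?n" ?m j] assms(1) by simp
qed

text \<open>[d_-1, d_(-1-n)] = -n d_(-2-n). The coefficient vanishes for n = 0, so degree -2 has to
  be given.\<close>

lemma D_kill_negative:
  assumes "\<And>j. D (- 1) j v = 0" "\<And>j. D (- 2) j v = 0" "k < 0"
  shows "D k j v = 0"
proof -
  have "D (- int (Suc n)) j v = 0" for n j
  proof (induction n arbitrary: j)
    case 0
    then show ?case using assms(1) by simp
  next
    case (Suc n)
    show ?case
    proof (cases "n = 0")
      case True
      then show ?thesis using assms(2) by simp
    next
      case False
      have "- 1 + (- 1 - int n) = - 2 - int n"
        by simp
      then show ?thesis
        using D_D[of "- 1" 0 "- int (Suc n)" j v] assms(1) Suc False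
        by (simp add: D_simps)
    qed
  qed
  from this[of "nat (- k - 1)"] show ?thesis
    using assms(3) by simp
qed

subsection \<open>Polynomial combinations of loop operators\<close>

text \<open>\<open>DP p k j\<close> and \<open>ZP p j\<close> are the operators of \<open>d_k \<otimes> p(t) t^j\<close> and \<open>c \<otimes> p(t) t^j\<close>.\<close>

definition DP :: "complex poly \<Rightarrow> int \<Rightarrow> int \<Rightarrow> 'v \<Rightarrow> 'v"
  where "DP p k j v = poly_comb p (\<lambda>s. D k (j + int s) v)"

definition ZP :: "complex poly \<Rightarrow> int \<Rightarrow> 'v \<Rightarrow> 'v"
  where "ZP p j v = poly_comb p (\<lambda>s. Z (j + int s) v)"

lemma lin_DP: "lin (DP p k j)"
  by (rule linI) (simp_all add: DP_def D_simps poly_comb_vec_add poly_comb_vec_scale)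

lemma lin_ZP: "lin (ZP p j)"
  by (rule linI) (simp_all add: ZP_def Z_simps poly_comb_vec_add poly_comb_vec_scale)

text \<open>Brackets multiply the loop factors, so a factor p passes through them: the elements with
  a factor p form an ideal.\<close>

lemma D_DP: "D i l (DP p k j v) = DP p k j (D i l v) + scale (of_int (k - i)) (DP p (i + k) (l + j) v) +
   (if i + k = 0 then scale (of_int (i ^ 3 - i) / 12) (ZP p (l + j) v) else 0)"
proof -
  have "D i l (DP p k j v) = poly_comb p (\<lambda>s. D k (j + int s) (D i l v) +
      (scale (of_int (k - i)) (D (i + k) (l + j + int s) v) +
        (if i + k = 0 then scale (of_int (i ^ 3 - i) / 12) (Z (l + j + int s) v) else 0)))"
    unfolding DP_def lin_poly_comb[OF lin_D] by (rule poly_comb_cong) (subst D_D, simp add: add_ac)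
  then show ?thesis
    by (simp add: DP_def ZP_def poly_comb_vec_add poly_comb_vec_scale)
qed

lemma Z_DP: "Z l (DP p k j v) = DP p k j (Z l v)"
  by (simp add: DP_def lin_poly_comb[OF lin_Z] D_Z)

lemma D_ZP: "D k j (ZP p l v) = ZP p l (D k j v)"
  by (simp add: ZP_def lin_poly_comb[OF lin_D] D_Z)

lemma Z_ZP: "Z j (ZP p l v) = ZP p l (Z j v)"
  by (simp add: ZP_def lin_poly_comb[OF lin_Z] Z_Z[of j])

section \<open>Polynomials annihilating a weight space in a given degree\<close>

definition no_lowest :: bool
  where "no_lowest \<longleftrightarrow> (\<forall>\<nu>. \<forall>w\<in>wt \<nu>. (\<forall>k<0. \<forall>j. D k j w = 0) \<longrightarrow> w = 0)"

definition no_highest :: bool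
  where "no_highest \<longleftrightarrow> (\<forall>\<nu>. \<forall>w\<in>wt \<nu>. (\<forall>k>0. \<forall>j. D k j w = 0) \<longrightarrow> w = 0)"

definition kills :: "complex poly \<Rightarrow> complex \<Rightarrow> int \<Rightarrow> bool"
  where "kills p \<mu> k \<longleftrightarrow> (\<forall>j. \<forall>v\<in>wt \<mu>. DP p k j v = 0)"

lemma kills_mult: "kills p \<mu> k \<Longrightarrow> kills (q * p) \<mu> k"
  by (simp add: kills_def DP_def poly_comb_mult add.assoc[symmetric])

text \<open>[d_1, d_k p] = (k - 1) d_(k+1) p, and \<open>D 1 0\<close> leads from weight \<mu> to
  \<mu> + 1. The separate variable \<open>k'\<close> admits any arithmetic form of k + 1.\<close>

lemma kills_Suc:
  assumes "kills p \<mu> k" "kills p (\<mu> + 1) k" "k \<noteq> 1" "k \<noteq> - 1" "k' = k + 1"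
  shows "kills p \<mu> k'"
  unfolding kills_def
proof (intro allI ballI)
  fix j v assume v: "v \<in> wt \<mu>"
  have "D 1 0 v \<in> wt (\<mu> + 1)"
    using D_wt[OF v, of 1 0] by simp
  then have "scale (of_int (k - 1)) (DP p (1 + k) j v) = 0"
    using D_DP[of 1 0 p k j v] assms v by (simp add: kills_def D_simps)
  then show "DP p k' j v = 0"
    using assms(3,5) by (simp add: add.commute del: of_int_diff)
qed

text \<open>
  If \<open>p\<close> does not kill \<open>v\<close> in degree \<open>k\<close>, then \<open>DP p k j v\<close> is annihilated by all \<open>D (-1) l\<close> and
  all \<open>D (-2) l\<close>, as the commutators only involve the cases that are assumed to be killed.
\<close>

lemma kills_by_lowering:
  assumes low: no_lowest
    and kills: "kills p (\<mu> - 1) k" "kills p (\<mu> - 2) k" "kills p \<mu> (k - 1)" "kills p \<mu> (k - 2)"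
    and "k > 2"
  shows "kills p \<mu> k"
  unfolding kills_def
proof (intro allI ballI)
  fix j v assume v: "v \<in> wt \<mu>"
  let ?w = "DP p k j v"
  have "D (- 1) l v \<in> wt (\<mu> - 1)" "D (- 2) l v \<in> wt (\<mu> - 2)" for l
    using D_wt[OF v, of "- 1" l] D_wt[OF v, of "- 2" l] by simp_all
  moreover have "- 1 + k = k - 1" "- 2 + k = k - 2" by simp_all
  \<comment> \<open>As k > 2, neither commutator has degree 0, so no central term appears.\<close>
  ultimately have "D (- 1) l ?w = 0" "D (- 2) l ?w = 0" for l
    using kills v \<open>k > 2\<close> D_DP[of "- 1" l p k j v] D_DP[of "- 2" l p k j v]
    by (simp_all add: kills_def)
  then have "D m l ?w = 0" if "m < 0" for m l
    using D_kill_negative that by blast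
  moreover have "?w \<in> wt (\<mu> + of_int k)"
    unfolding DP_def using subspace_wt D_wt[OF v] by (rule poly_comb_mem)
  ultimately show "?w = 0"
    using low unfolding no_lowest_def by blast
qed

text \<open>Three weights advance together. Degree n + 3 at \<mu> comes from
  \<open>kills_by_lowering\<close>; \<open>kills_Suc\<close> then gives degree n + 4 at \<mu> - 1,
  and from this degree n + 5 at \<mu> - 2.\<close>

lemma kills_all_positive:
  assumes low: no_lowest
    and base: "kills p \<mu> 1" "kills p \<mu> 2" "kills p (\<mu> - 1) 2" "kills p (\<mu> - 1) 3"
      "kills p (\<mu> - 2) 3" "kills p (\<mu> - 2) 4"
    and "k > 0"
  shows "kills p \<mu> k"
proof -
  have "(\<forall>k. 1 \<le> k \<and> k \<le> int n + 2 \<longrightarrow> kills p \<mu> k) \<and>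
    (\<forall>k. 2 \<le> k \<and> k \<le> int n + 3 \<longrightarrow> kills p (\<mu> - 1) k) \<and>
    (\<forall>k. 3 \<le> k \<and> k \<le> int n + 4 \<longrightarrow> kills p (\<mu> - 2) k)" for n
  proof (induction n)
    case 0
    have "k = 1 \<or> k = 2" if "1 \<le> k" "k \<le> 2" for k :: int
      using that by linarith
    moreover have "k = 2 \<or> k = 3" if "2 \<le> k" "k \<le> 3" for k :: int
      using that by linarith
    moreover have "k = 3 \<or> k = 4" if "3 \<le> k" "k \<le> 4" for k :: int
      using that by linarith
    ultimately show ?case
      using base by fastforce
  next
    case (Suc n)
    have 0: "kills p \<mu> (int n + 3)"
      by (rule kills_by_lowering[OF low]) (use Suc in auto)
    have 1: "kills p (\<mu> - 1) (int n + 4)"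
      by (rule kills_Suc[of _ _ "int n + 3"]) (use Suc 0 in auto)
    have 2: "kills p (\<mu> - 2) (int n + 5)"
      by (rule kills_Suc[of _ _ "int n + 4"]) (use Suc 1 in auto)
    show ?case
    proof (intro conjI allI impI)
      fix k assume "1 \<le> k \<and> k \<le> int (Suc n) + 2"
      then have "1 \<le> k \<and> (k \<le> int n + 2 \<or> k = int n + 3)" by linarith
      then show "kills p \<mu> k" using Suc 0 by auto
    next
      fix k assume "2 \<le> k \<and> k \<le> int (Suc n) + 3"
      then have "2 \<le> k \<and> (k \<le> int n + 3 \<or> k = int n + 4)" by linarith
      then show "kills p (\<mu> - 1) k" using Suc 1 by auto
    next
      fix k assume "3 \<le> k \<and> k \<le> int (Suc n) + 4"
      then have "3 \<le> k \<and> (k \<le> int n + 4 \<or> k = int n + 5)" by linarith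
      then show "kills p (\<mu> - 2) k" using Suc 2 by auto
    qed
  qed
  from this[of "nat k"] show ?thesis
    using \<open>k > 0\<close> by simp
qed

text \<open>The leading coefficient determines a term from the preceding ones, and the constant
  coefficient determines it from the following ones.\<close>

lemma recurrence_zero:
  fixes y :: "int \<Rightarrow> 'v"
  assumes p0: "poly.coeff p 0 \<noteq> 0" and rec: "\<And>j. poly_comb p (\<lambda>s. y (j + int s)) = 0"
    and init: "\<And>j. 0 \<le> j \<Longrightarrow> j < int (degree p) \<Longrightarrow> y j = 0"
  shows "y j = 0"
proof -
  have fwd: "y (int n) = 0" for n
  proof (induction n rule: less_induct)
    case (less n)
    show ?case
    proof (cases "n < degree p")
      case True
      then show ?thesis using init by simp
    next
      case False
      have "y (int n - int (degree p) + int i) = 0" if "i < degree p" for i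
      proof -
        have "int n - int (degree p) + int i = int (n - degree p + i)"
          using False by simp
        then show ?thesis
          using less[of "n - degree p + i"] that False by (simp only:)
      qed
      then have "poly_comb p (\<lambda>s. y (int n - int (degree p) + int s)) = scale (lead_coeff p) (y (int n))"
        unfolding poly_comb_def by (subst sum.remove[of _ "degree p"]) auto
      moreover have "p \<noteq> 0"
        using p0 by auto
      ultimately show ?thesis
        using rec[of "int n - int (degree p)"] by simp
    qed
  qed
  have bwd: "y (- int n) = 0" for n
  proof (induction n rule: less_induct)
    case (less n)
    have "y (- int n + int i) = 0" if "i \<noteq> 0" for i
    proof (cases "i \<le> n")
      case True
      then have "- int n + int i = - int (n - i)" by simp
      then show ?thesis
        using less[of "n - i"] that True by simp
    next
      case False
      then have "- int n + int i = int (i - n)" by simp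
      then show ?thesis by (simp only: fwd)
    qed
    then have "poly_comb p (\<lambda>s. y (- int n + int s)) = scale (poly.coeff p 0) (y (- int n))"
      unfolding poly_comb_def by (subst sum.remove[of _ 0]) auto
    then show ?case
      using rec[of "- int n"] p0 by simp
  qed
  show ?thesis
    using fwd[of "nat j"] bwd[of "nat (- j)"] by (cases "j \<ge> 0") auto
qed

end

subsection \<open>Irreducible modules with finite-dimensional weight spaces\<close>

locale loop_hc = loop_ops +
  assumes fin_dim: "\<exists>B. finite B \<and> span B = wt \<mu>"
    and irreducible: "subspace U \<Longrightarrow> (\<And>k j v. v \<in> U \<Longrightarrow> D k j v \<in> U) \<Longrightarrow> (\<And>j v. v \<in> U \<Longrightarrow> Z j v \<in> U) \<Longrightarrow>
      U = {0} \<or> U = UNIV"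
    and nontrivial: "\<exists>\<mu>. wt \<mu> \<noteq> {0}"
begin

lemma wt_basis:
  obtains B where "finite B" "independent B" "span B = wt \<mu>" "card B = dim (wt \<mu>)"
  using fin_dim[of \<mu>] subspace_basis[OF subspace_wt] by (metis order_refl)

text \<open>
  The operators \<open>D k j\<close> on a weight space span a finite-dimensional space, which gives a
  polynomial for \<open>j = 0\<close>; commuting with \<open>D 0 j\<close> extends it to all \<open>j\<close> as \<open>k \<noteq> 0\<close>.
\<close>

lemma ex_kills:
  assumes "k \<noteq> 0"
  shows "\<exists>p. p \<noteq> 0 \<and> kills p \<mu> k"
proof -
  interpret F: complex_space "\<lambda>a f i. scale a (f i) :: 'a"
    by (rule complex_space_fun) unfold_locales
  obtain B where B: "finite B" "span B = wt \<mu>"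
    using fin_dim by blast
  obtain C where C: "finite C" "span C = wt (\<mu> + of_int k)"
    using fin_dim by blast
  \<comment> \<open>The restriction of \<open>D k s\<close> to the spanning set \<open>B\<close>
    becomes one vector of a function space; the value 0 off \<open>B\<close> keeps the span
    finite-dimensional.\<close>
  define u where "u s b = (if b \<in> B then D k (int s) b else 0)" for s b
  have "u s \<in> F.span (\<Union>b\<in>B. point_fun b ` C)" for s
  proof (rule fun_mem_span_points)
    show "complex_space scale" by unfold_locales
    show "u s b \<in> span C" if "b \<in> B" for b
      using that B(2) C(2) D_wt[of b \<mu>] span_base[OF that] by (simp add: u_def)
  qed (use B in \<open>auto simp: u_def\<close>)
  then have "range u \<subseteq> F.span (\<Union>b\<in>B. point_fun b ` C)"
    by blast
  then obtain p where p: "p \<noteq> 0" "F.poly_comb p u = 0"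
    using F.poly_relation[of "\<Union>b\<in>B. point_fun b ` C" u] B(1) C(1) by auto
  have sum_fun: "sum f A b = (\<Sum>i\<in>A. f i b)" for f :: "nat \<Rightarrow> 'a \<Rightarrow> 'a" and A b
    by (induction A rule: infinite_finite_induct) auto
  have "F.poly_comb p u b = poly_comb p (\<lambda>s. u s b)" for b
    by (simp add: F.poly_comb_def poly_comb_def sum_fun)
  then have u0: "poly_comb p (\<lambda>s. u s b) = 0" for b
    using p(2) by simp
  have kill_B: "DP p k 0 b = 0" if "b \<in> B" for b
    using u0[of b] that by (simp add: DP_def u_def)
  have kill_0: "DP p k 0 v = 0" if "v \<in> wt \<mu>" for v
    using that unfolding B(2)[symmetric]
    by (induction v rule: span_induct_alt) (auto simp: lin_zero lin_add lin_scale lin_DP kill_B)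
  have "DP p k j v = 0" if "v \<in> wt \<mu>" for j v
    using D_DP[of 0 j p k 0 v] kill_0[OF that] kill_0[OF D0_wt[OF that]] assms by (simp add: D_simps)
  then show ?thesis
    using p(1) by (auto simp: kills_def)
qed

lemma ex_kills_finite:
  assumes "finite S" "\<And>c k. (c, k) \<in> S \<Longrightarrow> k \<noteq> 0"
  shows "\<exists>p. p \<noteq> 0 \<and> (\<forall>(c, k)\<in>S. kills p (\<mu> + c) k)"
  using assms
proof (induction S rule: finite_induct)
  case empty
  show ?case by (intro exI[of _ 1]) simp
next
  case (insert x S)
  obtain c k where x: "x = (c, k)" by fastforce
  obtain p where p: "p \<noteq> 0" "\<forall>(c, k)\<in>S. kills p (\<mu> + c) k"
    using insert by auto
  obtain q where q: "q \<noteq> 0" "kills q (\<mu> + c) k"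
    using ex_kills[of k "\<mu> + c"] insert.prems x by blast
  have "\<forall>(c, k)\<in>insert x S. kills (p * q) (\<mu> + c) k"
    using p q x kills_mult[of q _ _ p] kills_mult[of p _ _ q] by (auto simp: mult.commute[of q p])
  then show ?case
    using p q by (intro exI[of _ "p * q"]) simp
qed

text \<open>\<open>U\<close> is the annihilator of the ideal Vir \<otimes> p C[t,1/t], hence a
  submodule, and it contains the non-zero vector \<open>v\<close>.\<close>

lemma D_killed_everywhere:
  assumes v: "v \<noteq> 0" "\<And>k j. DP p k j v = 0" "\<And>j. ZP p j v = 0"
  shows "DP p k j w = 0"
proof -
  define U where "U = {u. (\<forall>k j. DP p k j u = 0) \<and> (\<forall>j. ZP p j u = 0)}"
  have sub: "subspace U"
    by (auto simp: U_def subspace_def lin_zero lin_add lin_scale lin_DP lin_ZP)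
  have DU: "D i l u \<in> U" if "u \<in> U" for i l u
  proof -
    have u: "DP p k j u = 0" "ZP p j u = 0" for k j
      using that by (auto simp: U_def)
    have "DP p k j (D i l u) = 0" "ZP p j (D i l u) = 0" for k j
      using D_DP[of i l p k j u] D_ZP[of i l p j u] u
      by (cases "i + k = 0"; simp add: D_simps)+
    then show ?thesis
      by (simp add: U_def)
  qed
  have ZU: "Z l u \<in> U" if "u \<in> U" for l u
    using that by (auto simp: U_def Z_DP[symmetric] Z_ZP[symmetric] Z_simps)
  have "U = {0} \<or> U = UNIV"
    using sub DU ZU by (rule irreducible)
  moreover have "v \<in> U"
    using v by (simp add: U_def)
  ultimately have "U = UNIV"
    using v(1) by blast
  then show ?thesis
    by (auto simp: U_def)
qed

text \<open>
  The second hypothesis is the mirror image of \<open>kills_all_positive\<close>.  The pairs in \<open>S\<close> below are the initial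
  cases of both, and the two that serve to reach degree \<open>0\<close> by commutators with \<open>D (-1)\<close> and \<open>D (-2)\<close>.
\<close>

lemma kill_loop_ideal:
  assumes low: no_lowest
    and neg: "\<And>p \<mu>. kills p \<mu> (- 1) \<Longrightarrow> kills p \<mu> (- 2) \<Longrightarrow>
      kills p (\<mu> + 1) (- 2) \<Longrightarrow> kills p (\<mu> + 1) (- 3) \<Longrightarrow>
      kills p (\<mu> + 2) (- 3) \<Longrightarrow> kills p (\<mu> + 2) (- 4) \<Longrightarrow> (\<And>k. k < 0 \<Longrightarrow> kills p \<mu> k)"
  shows "\<exists>p. poly.coeff p 0 \<noteq> 0 \<and> (\<forall>k j v. DP p k j v = 0)"
proof -
  obtain \<mu> v where v: "v \<in> wt \<mu>" "v \<noteq> 0"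
    using nontrivial zero_wt by blast
  define S :: "(complex \<times> int) set" where "S =
    {(0, 1), (0, 2), (- 1, 2), (- 1, 3), (- 2, 3), (- 2, 4),
     (- 1, 1), (- 2, 2), (0, - 1), (0, - 2), (1, - 2), (1, - 3), (2, - 3), (2, - 4)}"
  obtain p where p: "p \<noteq> 0" "\<forall>(c, k)\<in>S. kills p (\<mu> + c) k"
    using ex_kills_finite[of S \<mu>] by (fastforce simp: S_def)
  have pos: "kills p \<mu> k" if "k > 0" for k
    using kills_all_positive[OF low, where p = p and \<mu> = \<mu> and k = k] p(2) that by (simp add: S_def)
  have neg': "kills p \<mu> k" if "k < 0" for k
    using neg[of p \<mu> k] p(2) that by (simp add: S_def)
  have d1: "D (- 1) j w \<in> wt (\<mu> - 1)" if "w \<in> wt \<mu>" for j w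
    using D_wt[OF that, of "- 1" j] by simp
  have d2: "D (- 2) j w \<in> wt (\<mu> - 2)" if "w \<in> wt \<mu>" for j w
    using D_wt[OF that, of "- 2" j] by simp
  have km: "kills p (\<mu> - 1) 1" "kills p (\<mu> - 2) 2"
    using p(2) by (simp_all add: S_def)
  \<comment> \<open>[d_-1, d_1 p] = 2 d_0 p; the central coefficient is 0, since (-1)^3 =
    -1.\<close>
  have z0: "DP p 0 j w = 0" if "w \<in> wt \<mu>" for j w
    using D_DP[of "- 1" 0 p 1 j w] pos[of 1] km(1) d1 that by (simp add: kills_def D_simps)
  \<comment> \<open>In [d_-2, d_2 p] the central coefficient is -1/2, while the d_0 term is killed
    by \<open>z0\<close>.\<close>
  have "ZP p j v = 0" for j
    using D_DP[of "- 2" 0 p 2 j v] pos[of 2] km(2) d2 z0 v by (simp add: kills_def D_simps)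
  moreover have "DP p k j v = 0" for k j
    using pos[of k] neg'[of k] z0 v unfolding kills_def by (metis linorder_neqE)
  ultimately have all: "DP p k j w = 0" for k j w
    using D_killed_everywhere v(2) by blast
  \<comment> \<open>Factors X of \<open>p\<close> can be stripped off: as t is invertible, they only
    shift \<open>j\<close>.\<close>
  from p(1) all show ?thesis
  proof (induction p)
    case (pCons a p)
    show ?case
    proof (cases "a = 0")
      case True
      then have "p \<noteq> 0"
        using pCons.hyps by simp
      moreover have "DP p k j w = DP (pCons a p) k (j - 1) w" for k j w
        by (simp add: True DP_def poly_comb_pCons)
      then have "DP p k j w = 0" for k j w
        using pCons.prems by simp
      ultimately show ?thesis
        using pCons.IH by blast
    next
      case False
      then show ?thesis
        using pCons.prems by (intro exI[of _ "pCons a p"]) simp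
    qed
  qed simp
qed

text \<open>
  The level of a vector is the least \<open>n\<close> such that all \<open>D k j\<close> with \<open>k \<ge> n\<close> annihilate it.
  If \<open>J + 1\<close> is the least level occurring anywhere, with \<open>J \<ge> 1\<close>, then some \<open>D J j\<close> never vanishes
  on the vectors of that level, so that these occur in infinitely many weights
  \<open>\<mu> + m J\<close>.  Moving them back to weight \<open>\<mu>\<close> by powers of \<open>D (-1) 0\<close> produces vectors of
  unbounded levels in one weight space.
\<close>

lemma highest_vector_from_level:
  assumes "v \<in> wt \<mu>" "v \<noteq> 0" "\<And>k j. k \<ge> K \<Longrightarrow> D k j v = 0"
  shows "\<exists>\<nu> w. w \<in> wt \<nu> \<and> w \<noteq> 0 \<and> (\<forall>k j. k > 0 \<longrightarrow> D k j w = 0)"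
proof -
  define Q where "Q n \<longleftrightarrow> (\<exists>\<mu> v. v \<in> wt \<mu> \<and> v \<noteq> 0 \<and> (\<forall>k j. k \<ge> int n \<longrightarrow> D k j v = 0))" for n
  have "Q (nat K)"
    unfolding Q_def using assms by (intro exI[of _ \<mu>] exI[of _ v]) auto
  then obtain n where n: "Q n" "\<And>m. m < n \<Longrightarrow> \<not> Q m"
    by (metis exists_least_iff)
  obtain \<mu> v where v: "v \<in> wt \<mu>" "v \<noteq> 0" "\<And>k j. k \<ge> int n \<Longrightarrow> D k j v = 0"
    using n(1) unfolding Q_def by blast
  show ?thesis
  proof (cases "n \<le> 1")
    case True
    then have "\<forall>k j. k > 0 \<longrightarrow> D k j v = 0"
      using v(3) by auto
    then show ?thesis using v(1,2) by blast
  next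
    case False
    define J where "J = n - 1"
    have J: "J \<ge> 1" "int n = int J + 1"
      using False by (auto simp: J_def)
    \<comment> \<open>Without such a \<open>j\<close> the vector would have level at most J, against
      the minimality of \<open>n\<close>.\<close>
    have nz: "\<exists>j. D (int J) j w \<noteq> 0" if "w \<in> wt \<nu>" "w \<noteq> 0" "\<And>k j. k \<ge> int n \<Longrightarrow> D k j w = 0" for w \<nu>
    proof (rule ccontr)
      assume "\<not> ?thesis"
      then have "D k j w = 0" if "k \<ge> int J" for k j
        using that \<open>\<And>k j. k \<ge> int n \<Longrightarrow> D k j w = 0\<close>[of k j] J by (cases "k = int J") auto
      then have "Q J"
        using that unfolding Q_def by blast
      then show False
        using n(2)[of J] False by (simp add: J_def)
    qed
    have ex: "\<exists>w. w \<in> wt (\<mu> + of_nat (m * J)) \<and> w \<noteq> 0 \<and> (\<forall>k j. k \<ge> int n \<longrightarrow> D k j w = 0)" for m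
    proof (induction m)
      case 0
      then show ?case using v by auto
    next
      case (Suc m)
      then obtain w where w: "w \<in> wt (\<mu> + of_nat (m * J))" "w \<noteq> 0" "\<And>k j. k \<ge> int n \<Longrightarrow> D k j w = 0"
        by blast
      obtain j where j: "D (int J) j w \<noteq> 0"
        using nz w by blast
      have "D (int J) j w \<in> wt (\<mu> + of_nat (Suc m * J))"
        using D_wt[OF w(1), of "int J" j] by (simp add: algebra_simps)
      moreover have "D k l (D (int J) j w) = 0" if "k \<ge> int n" for k l
        using D_D[of k l "int J" j w] w(3) that J by (simp add: D_simps)
      ultimately show ?case
        using j by blast
    qed
    then obtain w where w: "\<And>m. w m \<in> wt (\<mu> + of_nat (m * J))" "\<And>m. w m \<noteq> 0"
      "\<And>m k j. k \<ge> int n \<Longrightarrow> D k j (w m) = 0"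
      by metis
    let ?T = "D (- 1) 0"
    have T_wt: "(?T ^^ a) x \<in> wt (\<nu> - of_nat a)" if "x \<in> wt \<nu>" for a x \<nu>
    proof (induction a)
      case (Suc a)
      then show ?case
        using D_wt[OF Suc, of "- 1" 0] by (simp add: algebra_simps)
    qed (use that in simp)
    \<comment> \<open>Each d_-1 raises the level by exactly one: [d_-1, d_k] = (k + 1) d_(k-1), with
      a non-zero coefficient at the decisive k = J + a + 1.\<close>
    have level: "(\<forall>k j. k \<ge> int n + int a \<longrightarrow> D k j ((?T ^^ a) (w m)) = 0) \<and>
      (\<exists>j. D (int J + int a) j ((?T ^^ a) (w m)) \<noteq> 0)" for a m
    proof (induction a)
      case 0
      have "\<exists>j. D (int J) j (w m) \<noteq> 0"
        by (rule nz[OF w(1) w(2) w(3)])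
      then show ?case
        using w(3) by simp
    next
      case (Suc a)
      let ?x = "(?T ^^ a) (w m)"
      have comm: "D k j (?T ?x) = ?T (D k j ?x) - scale (of_int (k + 1)) (D (k - 1) j ?x)" for k j
        using D_D[of "- 1" 0 k j ?x] by simp
      obtain j where j: "D (int J + int a) j ?x \<noteq> 0"
        using Suc by blast
      have "D (int J + int a + 1) j ?x = 0"
        using Suc J by simp
      then have "D (int J + int a + 1) j (?T ?x) \<noteq> 0"
        using comm[of "int J + int a + 1" j] j by (simp add: D_simps del: of_int_add)
      moreover have "D k l (?T ?x) = 0" if "k \<ge> int n + int a + 1" for k l
        using comm[of k l] Suc that by (simp add: D_simps)
      ultimately show ?case
        by (auto simp: add.assoc add.commute[of 1])
    qed
    define u where "u m = (?T ^^ (m * J)) (w m)" for m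
    have u_wt: "u m \<in> wt \<mu>" for m
      using T_wt[OF w(1), of "m * J" m] by (simp add: u_def)
    obtain B where B: "finite B" "span B = wt \<mu>"
      using fin_dim by blast
    then obtain p where p: "p \<noteq> 0" "poly_comb p u = 0"
      using poly_relation[of B u] u_wt by auto
    let ?d = "degree p"
    \<comment> \<open>In degree J + deg p * J only the leading vector of the relation survives: for
      i < deg p the level n + i * J of \<open>u i\<close> is at most that degree, as n = J + 1 and J
      is at least 1.\<close>
    obtain j where j: "D (int J + int (?d * J)) j (u ?d) \<noteq> 0"
      using level[of "?d * J" ?d] by (auto simp: u_def)
    have "D (int J + int (?d * J)) j (u i) = 0" if "i < ?d" for i
    proof -
      have "Suc i * J \<le> ?d * J"
        using that by (intro mult_right_mono) auto
      then have "n + i * J \<le> J + ?d * J"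
        using J by simp
      then have "int n + int (i * J) \<le> int J + int (?d * J)"
        by (simp only: of_nat_add[symmetric] of_nat_le_iff)
      then show ?thesis
        using level[of "i * J" i] by (simp add: u_def)
    qed
    then have "poly_comb p (\<lambda>i. D (int J + int (?d * J)) j (u i)) =
        scale (lead_coeff p) (D (int J + int (?d * J)) j (u ?d))"
      unfolding poly_comb_def by (subst sum.remove[of _ ?d]) auto
    moreover have "poly_comb p (\<lambda>i. D (int J + int (?d * J)) j (u i)) = 0"
      using p(2) by (simp add: lin_zero lin_D flip: lin_poly_comb[OF lin_D])
    ultimately show ?thesis
      using j p(1) by simp
  qed
qed

text \<open>The target weights \<kappa> and \<kappa> + 1 do not depend on \<open>i\<close>, which
  makes the bound uniform on one side of \<kappa>.\<close>

lemma dim_wt_bound: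
  assumes high: no_highest
    and p: "poly.coeff p 0 \<noteq> 0" "\<And>k j v. DP p k j v = 0"
    and "i \<ge> 1"
  shows "dim (wt (\<kappa> - of_int i)) \<le> 2 * degree p * (dim (wt \<kappa>) + dim (wt (\<kappa> + 1)))"
proof -
  interpret F: complex_space "\<lambda>a f i. scale a (f i) :: 'a"
    by (rule complex_space_fun) unfold_locales
  let ?r = "degree p" and ?M = "dim (wt \<kappa>) + dim (wt (\<kappa> + 1))"
  define S where "S = {i, i + 1} \<times> {0..<int ?r}"
  define \<Phi> where "\<Phi> v = (\<lambda>(k, j). if (k, j) \<in> S then D k j v else 0)" for v
  interpret \<Phi>: Vector_Spaces.linear scale "\<lambda>a f i. scale a (f i)" \<Phi>
    by unfold_locales (auto simp: \<Phi>_def D_simps)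
  define W where "W = wt (\<kappa> - of_int i)"
  have ker: "v = 0" if "v \<in> W" "\<Phi> v = 0" for v
  proof -
    have S0: "D k j v = 0" if "(k, j) \<in> S" for k j
      using fun_cong[OF \<open>\<Phi> v = 0\<close>, of "(k, j)"] that by (simp add: \<Phi>_def)
    \<comment> \<open>The recurrence given by \<open>p\<close> extends the vanishing from 0 \<le> j
      < deg p to all integers j.\<close>
    have two: "D k j v = 0" if "k \<in> {i, i + 1}" for k j
      by (rule recurrence_zero[OF p(1), of "\<lambda>j. D k j v"])
        (use p(2) S0 that in \<open>auto simp: DP_def S_def\<close>)
    have kill: "D k j v = 0" if "k \<ge> i * (i + 1) + 1" for k j
      by (rule D_kill_from_two[OF assms(4)]) (use two that in auto)
    show ?thesis
    proof (rule ccontr)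
      assume "v \<noteq> 0"
      from highest_vector_from_level[OF \<open>v \<in> W\<close>[unfolded W_def] this kill]
      obtain \<nu> w where "w \<in> wt \<nu>" "w \<noteq> 0" "\<And>k j. k > 0 \<Longrightarrow> D k j w = 0"
        by blast
      then show False
        using high unfolding no_highest_def by blast
    qed
  qed
  obtain B where B: "finite B" "independent B" "span B = W" "card B = dim W"
    unfolding W_def by (rule wt_basis)
  have "inj_on \<Phi> W"
  proof (rule inj_onI)
    fix x y assume "x \<in> W" "y \<in> W" "\<Phi> x = \<Phi> y"
    then have "x - y \<in> W" "\<Phi> (x - y) = 0"
      using subspace_diff[OF subspace_wt] by (auto simp: W_def \<Phi>.diff)
    then show "x = y"
      using ker[of "x - y"] by simp
  qed
  then have indep: "F.independent (\<Phi> ` B)" and card: "card (\<Phi> ` B) = dim W"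
    using \<Phi>.independent_injective_image[OF B(2)] B span_superset
    by (auto simp: card_image inj_on_subset)
  obtain b where b: "\<And>\<mu>. finite (b \<mu>)" "\<And>\<mu>. span (b \<mu>) = wt \<mu>" "\<And>\<mu>. card (b \<mu>) = dim (wt \<mu>)"
  proof -
    have "\<exists>B. finite B \<and> span B = wt \<mu> \<and> card B = dim (wt \<mu>)" for \<mu>
      using wt_basis by metis
    then show ?thesis
      using that by metis
  qed
  \<comment> \<open>On \<open>S\<close> the target weight \<kappa> - i + k is \<kappa> or \<kappa> +
    1, so each of the 2 deg p points contributes at most \<open>?M\<close> vectors.\<close>
  define C where "C = (\<lambda>(k, j :: int). b (\<kappa> - of_int i + of_int k))"
  define X where "X = (\<Union>s\<in>S. point_fun s ` C s)"
  have "finite S"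
    by (simp add: S_def)
  have "\<Phi> v \<in> F.span X" if "v \<in> W" for v
    unfolding X_def
  proof (rule fun_mem_span_points)
    show "complex_space scale" by unfold_locales
    show "\<Phi> v s \<in> span (C s)" if "s \<in> S" for s
      using D_wt[OF \<open>v \<in> W\<close>[unfolded W_def]] that by (auto simp: \<Phi>_def C_def b split: prod.splits)
  qed (use \<open>finite S\<close> in \<open>auto simp: \<Phi>_def split: prod.splits\<close>)
  then have "\<Phi> ` B \<subseteq> F.span X"
    using B span_superset by blast
  moreover have "finite X"
    using \<open>finite S\<close> b(1) by (auto simp: X_def C_def split: prod.splits)
  ultimately have "dim W \<le> card X"
    using F.independent_span_bound[OF _ indep] card by metis
  also have "card X \<le> (\<Sum>s\<in>S. card (point_fun s ` C s))"
    unfolding X_def by (rule card_UN_le) fact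
  also have "\<dots> \<le> (\<Sum>s\<in>S. ?M)"
  proof (rule sum_mono)
    fix s assume "s \<in> S"
    have "card (point_fun s ` C s) \<le> card (C s)"
      by (rule card_image_le) (auto simp: C_def b split: prod.splits)
    also have "\<dots> \<le> ?M"
      using \<open>s \<in> S\<close> by (auto simp: C_def b S_def)
    finally show "card (point_fun s ` C s) \<le> ?M" .
  qed
  also have "\<dots> = 2 * ?r * ?M"
    by (simp add: S_def card_cartesian_product)
  finally show ?thesis
    by (simp add: W_def)
qed

text \<open>The weight spaces with weights in \<kappa> + Z span a non-zero submodule, hence
  everything; this leaves no room for a further weight.\<close>

lemma wt_support:
  assumes "wt \<kappa> \<noteq> {0}" "wt \<mu> \<noteq> {0}"
  shows "\<exists>n. \<mu> = \<kappa> + of_int n"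
proof (rule ccontr)
  assume *: "\<not> ?thesis"
  let ?S = "range (\<lambda>n. \<kappa> + of_int n)"
  let ?U = "span (\<Union>\<nu>\<in>?S. wt \<nu>)"
  have "D k j v \<in> ?U" if "v \<in> ?U" for k j v
    using that
  proof (induction v rule: span_induct_alt)
    case (step c x y)
    then obtain n where "x \<in> wt (\<kappa> + of_int n)"
      by blast
    then have "D k j x \<in> wt (\<kappa> + of_int (n + k))"
      using D_wt[of x "\<kappa> + of_int n" k j] by (simp add: add.assoc)
    then have "D k j x \<in> ?U"
      by (blast intro: span_base)
    then show ?case
      using step by (simp add: D_simps span_add span_scale)
  qed (simp add: D_simps span_zero)
  moreover have "Z j v \<in> ?U" if "v \<in> ?U" for j v
    using that
  proof (induction v rule: span_induct_alt)
    case (step c x y)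
    then have "Z j x \<in> ?U"
      using Z_wt by (blast intro: span_base)
    then show ?case
      using step by (simp add: Z_simps span_add span_scale)
  qed (simp add: Z_simps span_zero)
  moreover obtain v where v: "v \<in> wt \<kappa>" "v \<noteq> 0"
    using assms(1) zero_wt by blast
  then have "v \<in> wt (\<kappa> + of_int 0)"
    by simp
  then have "v \<in> ?U"
    by (blast intro: span_base)
  ultimately have U: "?U = UNIV"
    using irreducible[OF subspace_span] v by blast
  obtain w where w: "w \<in> wt \<mu>" "w \<noteq> 0"
    using assms(2) zero_wt by blast
  have "w = 0"
    by (rule wt_not_in_other_span[of w ?S \<mu>]) (use w U * in auto)
  then show False
    using w by simp
qed

text \<open>The joint annihilator \<open>U\<close> of the degrees in \<open>P\<close> inside
  \<open>wt \<nu>\<close> is stable under L_0, since brackets with d_0 \<otimes> t^j preserve the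
  degree and 0 is not in \<open>P\<close>. The operators of L_0 commute.\<close>

lemma common_eigenvector:
  assumes "w \<in> wt \<nu>" "w \<noteq> 0" and hi: "\<And>k j. k \<in> P \<Longrightarrow> D k j w = 0" and "0 \<notin> P"
  shows "\<exists>v\<in>wt \<nu>. v \<noteq> 0 \<and> (\<forall>k\<in>P. \<forall>j. D k j v = 0) \<and>
    (\<forall>j. \<exists>a. D 0 j v = scale a v) \<and> (\<forall>j. \<exists>a. Z j v = scale a v)"
proof -
  define U where "U = {v\<in>wt \<nu>. \<forall>k\<in>P. \<forall>j. D k j v = 0}"
  obtain B where B: "finite B" "span B = wt \<nu>"
    using fin_dim by blast
  have "subspace U"
    using subspace_wt[of \<nu>] by (auto simp: U_def subspace_def D_simps)
  moreover have "D 0 j v \<in> U" if "v \<in> U" for j v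
  proof -
    have "D k l (D 0 j v) = 0" if "k \<in> P" for k l
      using D_D[of k l 0 j v] that \<open>v \<in> U\<close> assms(4) by (auto simp: U_def D_simps)
    then show ?thesis
      using that D0_wt by (auto simp: U_def)
  qed
  moreover have "Z j v \<in> U" if "v \<in> U" for j v
    using that Z_wt by (auto simp: U_def D_Z Z_simps)
  ultimately have "\<exists>v\<in>U. v \<noteq> 0 \<and> (\<forall>T\<in>range (D 0) \<union> range Z. \<exists>a. T v = scale a v)"
  proof (intro common_eigenvector_exists[where B = B])
    show "S (T v) = T (S v)" if "S \<in> range (D 0) \<union> range Z" "T \<in> range (D 0) \<union> range Z" for S T v
    proof -
      have "D 0 i (D 0 j v) = D 0 j (D 0 i v)" for i j
        using D_D[of 0 i 0 j v] by simp
      then show ?thesis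
        using that D_Z Z_Z by fastforce
    qed
    show "U \<noteq> {0}"
      using assms by (auto simp: U_def)
  qed (use B lin_D lin_Z in \<open>auto simp: U_def\<close>)
  then show ?thesis
    by (auto simp: U_def)
qed

end

subsection \<open>The symmetry exchanging positive and negative degrees\<close>

text \<open>The automorphism d_k \<otimes> t^j -> -d_(-k) \<otimes> t^j, c \<otimes> t^j -> -c
  \<otimes> t^j of the algebra. It negates weights and degrees.\<close>

lemma (in loop_ops) loop_ops_mirror: "loop_ops scale (\<lambda>k j v. - D (- k) j v) (\<lambda>j v. - Z j v)"
proof unfold_locales
  fix i j k l v
  show "- D (- i) j (- D (- k) l v) = - D (- k) l (- D (- i) j v) +
      scale (of_int (k - i)) (- D (- (i + k)) (j + l) v) +
      (if i + k = 0 then scale (of_int (i ^ 3 - i) / 12) (- Z (j + l) v) else 0)"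
  proof (cases "i + k = 0")
    case True
    then have k: "k = - i" by simp
    have "(- i) ^ 3 - - i = - (i ^ 3 - i)"
      by (simp add: power3_eq_cube)
    then have "of_int ((- i) ^ 3 - - i) / 12 = - (of_int (i ^ 3 - i) / (12 :: complex))"
      by (simp only: of_int_minus minus_divide_left)
    then show ?thesis
      using D_D[of "- i" j "- k" l v] unfolding k
      by (simp add: D_simps scale_left_diff_distrib scale_minus_left)
  next
    case False
    then have "- i - k \<noteq> 0" by simp
    then show ?thesis
      using D_D[of "- i" j "- k" l v] False by (simp add: D_simps scale_left_diff_distrib)
  qed
qed (auto simp: D_simps Z_simps D_Z Z_Z[of j for j])


lemma (in loop_ops) mirror_wt:
  "loop_ops.wt scale (\<lambda>k j v. - D (- k) j v) \<mu> = wt (- \<mu>)"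
proof -
  interpret M: loop_ops scale "\<lambda>k j v. - D (- k) j v" "\<lambda>j v. - Z j v"
    by (rule loop_ops_mirror)
  show ?thesis
    by (auto simp: M.wt_def wt_def minus_equation_iff[of _ "scale \<mu> _"] eq_commute[of "- scale _ _"])
qed

lemma (in loop_ops) mirror_kills:
  "loop_ops.kills scale (\<lambda>k j v. - D (- k) j v) p \<mu> k \<longleftrightarrow> kills p (- \<mu>) (- k)"
proof -
  interpret M: loop_ops scale "\<lambda>k j v. - D (- k) j v" "\<lambda>j v. - Z j v"
    by (rule loop_ops_mirror)
  have "M.DP p k j v = - DP p (- k) j v" for j v
    using poly_comb_vec_scale[of p "- 1" "\<lambda>s. D (- k) (j + int s) v"] by (simp add: M.DP_def DP_def)
  then show ?thesis
    by (simp add: M.kills_def kills_def mirror_wt)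
qed

lemma (in loop_hc) loop_hc_mirror: "loop_hc scale (\<lambda>k j v. - D (- k) j v) (\<lambda>j v. - Z j v)"
proof -
  interpret M: loop_ops scale "\<lambda>k j v. - D (- k) j v" "\<lambda>j v. - Z j v"
    by (rule loop_ops_mirror)
  show ?thesis
  proof
    show "\<exists>B. finite B \<and> span B = M.wt \<mu>" for \<mu>
      using fin_dim by (simp add: mirror_wt)
    show "\<exists>\<mu>. M.wt \<mu> \<noteq> {0}"
      using nontrivial unfolding mirror_wt by (metis minus_minus)
  next
    fix U
    assume U: "subspace U" and D: "\<And>k j v. v \<in> U \<Longrightarrow> - D (- k) j v \<in> U"
      and Z: "\<And>j v. v \<in> U \<Longrightarrow> - Z j v \<in> U"
    have "D k j v \<in> U" if "v \<in> U" for k j v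
      using D[of v "- k" j] that subspace_neg[OF U, of "- D k j v"] by simp
    moreover have "Z j v \<in> U" if "v \<in> U" for j v
      using Z[of v j] that subspace_neg[OF U, of "- Z j v"] by simp
    ultimately show "U = {0} \<or> U = UNIV"
      using irreducible[OF U] by blast
  qed
qed

theorem (in loop_hc) weight_dims_bounded:
  assumes low: no_lowest and high: no_highest
  shows "\<exists>N. \<forall>\<mu>. wt \<mu> \<noteq> {0} \<longrightarrow> dim (wt \<mu>) < N"
proof -
  interpret M: loop_hc scale "\<lambda>k j v. - D (- k) j v" "\<lambda>j v. - Z j v"
    by (rule loop_hc_mirror)
  have M_low: M.no_lowest
    unfolding M.no_lowest_def mirror_wt
  proof (intro allI ballI impI)
    fix \<nu> w assume w: "w \<in> wt (- \<nu>)" "\<forall>k<0. \<forall>j. - D (- k) j w = 0"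
    have "D k j w = 0" if "k > 0" for k j
      using w(2)[rule_format, of "- k" j] that by simp
    then show "w = 0"
      using high w(1) unfolding no_highest_def by blast
  qed
  have M_high: M.no_highest
    unfolding M.no_highest_def mirror_wt
  proof (intro allI ballI impI)
    fix \<nu> w assume w: "w \<in> wt (- \<nu>)" "\<forall>k>0. \<forall>j. - D (- k) j w = 0"
    have "D k j w = 0" if "k < 0" for k j
      using w(2)[rule_format, of "- k" j] that by simp
    then show "w = 0"
      using low w(1) unfolding no_lowest_def by blast
  qed
  \<comment> \<open>This is \<open>kills_all_positive\<close> in the mirrored module at weight
    -\<mu>.\<close>
  have neg: "kills p \<mu> k" if "kills p \<mu> (- 1)" "kills p \<mu> (- 2)" "kills p (\<mu> + 1) (- 2)"
    "kills p (\<mu> + 1) (- 3)" "kills p (\<mu> + 2) (- 3)" "kills p (\<mu> + 2) (- 4)" "k < 0" for p \<mu> k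
    using M.kills_all_positive[OF M_low, where p = p and \<mu> = "- \<mu>" and k = "- k"] that
    by (simp add: mirror_kills add.commute)
  have "\<exists>p. poly.coeff p 0 \<noteq> 0 \<and> (\<forall>k j v. DP p k j v = 0)"
    by (rule kill_loop_ideal[OF low]) (rule neg)
  then obtain p where p: "poly.coeff p 0 \<noteq> 0" "\<And>k j v. DP p k j v = 0"
    by blast
  have M_p: "M.DP p k j v = 0" for k j v
    using p(2)[of "- k" j v] poly_comb_vec_scale[of p "- 1" "\<lambda>s. D (- k) (j + int s) v"]
    by (simp add: M.DP_def DP_def)
  obtain \<kappa> where \<kappa>: "wt \<kappa> \<noteq> {0}"
    using nontrivial by blast
  \<comment> \<open>One term for each side of \<kappa>, one for \<kappa> itself, and 1 for
    strictness.\<close>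
  define N where "N = 2 * degree p * (dim (wt \<kappa>) + dim (wt (\<kappa> + 1))) +
    2 * degree p * (dim (wt \<kappa>) + dim (wt (\<kappa> - 1))) + dim (wt \<kappa>) + 1"
  have "dim (wt \<mu>) < N" if nz: "wt \<mu> \<noteq> {0}" for \<mu>
  proof -
    obtain n where n: "\<mu> = \<kappa> + of_int n"
      using wt_support[OF \<kappa> nz] by blast
    consider "n = 0" | "- n \<ge> 1" | "n \<ge> 1"
      by linarith
    then show ?thesis
    proof cases
      case 1
      then show ?thesis by (simp add: n N_def)
    next
      case 2
      then show ?thesis
        using dim_wt_bound[OF high p, of "- n" \<kappa>] by (simp add: n N_def)
    next
      case 3
      then show ?thesis
        using M.dim_wt_bound[OF M_high p(1) M_p, of n "- \<kappa>"] by (simp add: n N_def mirror_wt add.commute)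
    qed
  qed
  then show ?thesis by blast
qed

subsection \<open>The enveloping algebra as a ring with generators\<close>

lemma update_eq_add:
  "a \<notin> Poly_Mapping.keys f \<Longrightarrow> Poly_Mapping.update a b f = f + Poly_Mapping.single a b"
  by (intro poly_mapping_eqI) (auto simp: lookup_update lookup_add lookup_single in_keys_iff when_def)

lemma poly_mapping_additive_induct [case_names single add]:
  assumes single: "\<And>k a. Q (Poly_Mapping.single k a)" and add: "\<And>p q. Q p \<Longrightarrow> Q q \<Longrightarrow> Q (p + q)"
  shows "Q (p :: 'a \<Rightarrow>\<^sub>0 'b::comm_monoid_add)"
proof (induction p rule: update_induct)
  case const
  show ?case
    using single[of undefined 0] by simp
next
  case (update f a b)
  then show ?case
    using add single by (simp add: update_eq_add)
qed

lemma loop_scale_single: "loop_scale a (Poly_Mapping.single b c) = Poly_Mapping.single b (a * c)"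
  by (simp add: loop_scale_def)

lemma lookup_loop_scale: "Poly_Mapping.lookup (loop_scale a x) b = a * Poly_Mapping.lookup x b"
  by (simp add: loop_scale_def Poly_Mapping.map.rep_eq when_def)

lemma loop_scale_add: "loop_scale a (x + y) = loop_scale a x + loop_scale a y"
  by (rule poly_mapping_eqI) (simp add: lookup_loop_scale lookup_add distrib_left)

lemma bracket_single:
  "bracket (Poly_Mapping.single a 1) (Poly_Mapping.single b 1) = basis_bracket a b"
proof -
  have "loop_scale 1 x = x" for x
    by (rule poly_mapping_eqI) (simp add: lookup_loop_scale)
  then show ?thesis
    by (simp add: bracket_def)
qed

abbreviation gen :: "loop_basis \<Rightarrow> uea"
  where "gen b \<equiv> uea_of (Poly_Mapping.single b 1)"

lemma tensor_of_add: "tensor_of (x + y) = tensor_of x + tensor_of y"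
  unfolding tensor_of_def by (rule setsum_keys_plus_distrib) (simp_all add: single_add)

lemma tensor_of_single: "tensor_of (Poly_Mapping.single b a) = Poly_Mapping.single (Word [b]) a"
  by (cases "a = 0") (simp_all add: tensor_of_def)

lemma tensor_of_scale: "tensor_of (loop_scale a x) = Poly_Mapping.single 0 a * tensor_of x"
  by (induction x rule: poly_mapping_additive_induct)
    (simp_all add: loop_scale_single tensor_of_single mult_single loop_scale_add tensor_of_add distrib_left)

lemma uea_of_add: "uea_of (x + y) = uea_of x + uea_of y"
  by transfer (simp add: tensor_of_add uea_rel_def uea_ideal.zero)

lemma uea_of_scale: "uea_of (loop_scale a x) = uea_scalar a * uea_of x"
  by transfer (simp add: tensor_of_scale uea_rel_def uea_ideal.zero)

lemma uea_of_zero [simp]: "uea_of 0 = 0"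
  using uea_of_add[of 0 0] by simp

lemma uea_of_single: "uea_of (Poly_Mapping.single b a) = uea_scalar a * gen b"
  using uea_of_scale[of a "Poly_Mapping.single b 1"] by (simp add: loop_scale_single)

lemma uea_scalar_0 [simp]: "uea_scalar 0 = 0"
  by transfer (simp add: uea_rel_def uea_ideal.zero)

lemma uea_scalar_1 [simp]: "uea_scalar 1 = 1"
  by transfer (simp add: uea_rel_def uea_ideal.zero)

lemma uea_scalar_add: "uea_scalar (a + b) = uea_scalar a + uea_scalar b"
  by transfer (simp add: single_add uea_rel_def uea_ideal.zero)

lemma uea_scalar_mult: "uea_scalar (a * b) = uea_scalar a * uea_scalar b"
  by transfer (simp add: mult_single uea_rel_def uea_ideal.zero)

lemma uea_scalar_minus: "uea_scalar (- a) = - uea_scalar a"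
  using uea_scalar_add[of a "- a"] by (simp add: eq_neg_iff_add_eq_0 add.commute)

lemma single_0_central: "Poly_Mapping.single 0 a * p = p * Poly_Mapping.single 0 a"
  for p :: tensor_alg
  by (induction p rule: poly_mapping_additive_induct)
    (simp_all add: mult_single distrib_left distrib_right mult.commute)

lemma uea_scalar_central: "uea_scalar a * u = u * uea_scalar a"
  by transfer (simp add: single_0_central uea_rel_def uea_ideal.zero)

lemma uea_scalar_left_commute: "u * (uea_scalar a * v) = uea_scalar a * (u * v)"
  by (metis mult.assoc uea_scalar_central)

lemma X_commute: "gen a * gen b = gen b * gen a + uea_of (basis_bracket a b)"
proof -
  have "uea_of x * uea_of y = uea_of y * uea_of x + uea_of (bracket x y)" for x y
    by transfer (simp only: uea_rel_def diff_diff_eq[symmetric] uea_ideal.relation)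
  from this[of "Poly_Mapping.single a 1" "Poly_Mapping.single b 1"] show ?thesis
    by (simp only: bracket_single)
qed

text \<open>The algebra is additively generated by scaled words, and a word arises from a scalar by
  multiplying generators from the left.\<close>

lemma uea_induct [case_names scalar add gen]:
  assumes scalar: "\<And>a. Q (uea_scalar a)" and add: "\<And>u v. Q u \<Longrightarrow> Q v \<Longrightarrow> Q (u + v)"
    and gen: "\<And>b u. Q u \<Longrightarrow> Q (gen b * u)"
  shows "Q u"
proof -
  have abs_add: "abs_uea (p + q) = abs_uea p + abs_uea q" for p q
    by (simp add: plus_uea.abs_eq)
  have abs_mult: "abs_uea (p * q) = abs_uea p * abs_uea q" for p q
    by (simp add: times_uea.abs_eq)
  have word: "Q (abs_uea (Poly_Mapping.single (Word bs) a))" for bs a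
  proof (induction bs)
    case Nil
    then show ?case
      using scalar[of a] by (simp add: uea_scalar.abs_eq zero_word_def)
  next
    case (Cons b bs)
    have "Poly_Mapping.single (Word (b # bs)) a =
      Poly_Mapping.single (Word [b]) 1 * Poly_Mapping.single (Word bs) a"
      by (simp add: mult_single plus_word_def)
    moreover have "abs_uea (Poly_Mapping.single (Word [b]) 1) = gen b"
      by (simp add: uea_of.abs_eq tensor_of_single)
    ultimately show ?case
      using gen[OF Cons] by (simp add: abs_mult)
  qed
  have "Q (abs_uea p)" for p
  proof (induction p rule: poly_mapping_additive_induct)
    case (single k a)
    then show ?case using word by (cases k) simp
  next
    case (add p q)
    then show ?case using assms(2) by (simp add: abs_add)
  qed
  then show ?thesis
    by (rule uea.abs_induct)
qed

text \<open>This makes \<open>separated_from\<close> and polynomials in left multiplication by d_0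
  available on the enveloping algebra.\<close>

interpretation U: complex_space "\<lambda>a u. uea_scalar a * u"
  by unfold_locales (auto simp: distrib_left distrib_right uea_scalar_add uea_scalar_mult mult.assoc)

lemma uea_of_mem:
  assumes "U.subspace R" "\<And>b. gen b * u \<in> R"
  shows "uea_of x * u \<in> R"
proof (induction x rule: poly_mapping_additive_induct)
  case (single b a)
  then show ?case
    using assms U.subspace_scale[OF assms(1), of "gen b * u" a] by (simp add: uea_of_single[of b a] mult.assoc)
next
  case (add x y)
  then show ?case
    using assms(1) by (simp add: uea_of_add distrib_right U.subspace_add)
qed

lemma lin_mult_left: "U.lin (\<lambda>u. w * u)"
  by (rule U.linI) (simp_all add: distrib_left uea_scalar_left_commute)

definition left_ideal :: "uea set \<Rightarrow> bool"
  where "left_ideal J \<longleftrightarrow> 0 \<in> J \<and> (\<forall>u\<in>J. \<forall>v\<in>J. u + v \<in> J) \<and> (\<forall>w. \<forall>u\<in>J. w * u \<in> J)"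

lemma left_ideal_subspace: "left_ideal J \<Longrightarrow> U.subspace J"
  by (simp add: left_ideal_def U.subspace_def)

subsection \<open>Words in the lowering generators\<close>

text \<open>
  The sign of \<open>\<sigma>\<close> selects the case: \<open>\<sigma> = 1\<close> for highest and \<open>\<sigma> = - 1\<close> for lowest weight modules.
\<close>

inductive lowering :: "int \<Rightarrow> int \<Rightarrow> uea \<Rightarrow> bool"
  for \<sigma>
  where
    scalar: "lowering \<sigma> 0 (uea_scalar a)"
  | step: "lowering \<sigma> m u \<Longrightarrow> \<sigma> * k < 0 \<Longrightarrow> lowering \<sigma> (m + k) (gen (D k, j) * u)"

text \<open>The words are not ordered. \<open>lowering_span_UNIV\<close> will show that this set is
  the whole algebra, the spanning part of the decomposition of U / I.\<close>

inductive_set lowering_span :: "int \<Rightarrow> uea set \<Rightarrow> uea set"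
  for \<sigma> I
  where
    word: "lowering \<sigma> m u \<Longrightarrow> u \<in> lowering_span \<sigma> I"
  | ideal: "u \<in> I \<Longrightarrow> u \<in> lowering_span \<sigma> I"
  | add: "u \<in> lowering_span \<sigma> I \<Longrightarrow> v \<in> lowering_span \<sigma> I \<Longrightarrow> u + v \<in> lowering_span \<sigma> I"

lemma lowering_scale: "lowering \<sigma> m u \<Longrightarrow> lowering \<sigma> m (uea_scalar a * u)"
proof (induction rule: lowering.induct)
  case (scalar b)
  show ?case
    unfolding uea_scalar_mult[symmetric] by (rule lowering.scalar)
next
  case (step m u k j)
  then show ?case
    unfolding uea_scalar_left_commute[of "gen (D k, j)", symmetric] by (blast intro: lowering.step)
qed

text \<open>Every letter pushes the degree strictly to one side, so only the empty word has degree
  0.\<close>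

lemma lowering_degree:
  "lowering \<sigma> m u \<Longrightarrow> \<sigma> * m \<le> 0 \<and> (m = 0 \<longrightarrow> (\<exists>a. u = uea_scalar a))"
proof (induction rule: lowering.induct)
  case (step m u k j)
  then have "\<sigma> * (m + k) < 0"
    by (simp add: distrib_left)
  then show ?case by auto
qed auto

text \<open>\<open>I\<close> models the annihilator of an extremal weight vector on which L_0 acts
  through \<phi> and \<psi>.\<close>

locale extremal_ideal =
  fixes \<sigma> :: int and I :: "uea set" and \<phi> \<psi> :: "int \<Rightarrow> complex"
  assumes sign: "\<sigma> \<noteq> 0"
    and I: "left_ideal I"
    and raise: "\<sigma> * k > 0 \<Longrightarrow> gen (D k, j) \<in> I"
    and diag: "gen (D 0, j) - uea_scalar (\<phi> j) \<in> I"
    and central: "gen (C, j) - uea_scalar (\<psi> j) \<in> I"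
begin

lemma subspace_I: "U.subspace I"
  using I by (rule left_ideal_subspace)

lemma I_mult: "u \<in> I \<Longrightarrow> w * u \<in> I"
  using I by (simp add: left_ideal_def)

lemma subspace_lowering_span: "U.subspace (lowering_span \<sigma> I)"
proof -
  have "uea_scalar a * u \<in> lowering_span \<sigma> I" if "u \<in> lowering_span \<sigma> I" for a u
    using that
    by induction (auto simp: distrib_left intro: lowering_span.intros lowering_scale I_mult)
  then show ?thesis
    using lowering_span.ideal[of 0 I \<sigma>] U.subspace_0[OF subspace_I]
    by (auto simp: U.subspace_def intro: lowering_span.add)
qed

lemma lowering_span_neg:
  assumes "\<sigma> * k < 0"
  shows "u \<in> lowering_span \<sigma> I \<Longrightarrow> gen (D k, j) * u \<in> lowering_span \<sigma> I"
proof (induction rule: lowering_span.induct)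
  case (word m u)
  then show ?case by (rule lowering_span.word[OF lowering.step[OF _ assms]])
next
  case (ideal u)
  then show ?case by (rule lowering_span.ideal[OF I_mult])
next
  case (add u v)
  then show ?case by (simp add: distrib_left lowering_span.add)
qed

text \<open>The generator is moved past the first letter of the word. The commutator is a
  combination of generators applied to the shorter word, which is why the induction ranges over all
  \<open>b\<close>; on scalars the generator is reduced modulo \<open>I\<close>.\<close>

lemma X_lowering: "lowering \<sigma> m u \<Longrightarrow> gen b * u \<in> lowering_span \<sigma> I"
proof (induction arbitrary: b rule: lowering.induct)
  case (scalar a)
  have diagonal: "gen b * uea_scalar a \<in> lowering_span \<sigma> I" if "gen b - uea_scalar c \<in> I" for c
  proof -
    have "gen b * uea_scalar a = uea_scalar a * (gen b - uea_scalar c) + uea_scalar (a * c)"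
      by (simp add: right_diff_distrib uea_scalar_mult uea_scalar_central[of a "gen b"])
    then show ?thesis
      using that by (auto intro: lowering_span.intros lowering.scalar I_mult)
  qed
  obtain l where l: "b = (C, l) \<or> (\<exists>k. b = (D k, l))"
    by (metis vir_basis.exhaust surj_pair)
  consider "\<exists>l. b = (C, l)" | "\<exists>l. b = (D 0, l)" | k l where "b = (D k, l)" "\<sigma> * k > 0"
    | k l where "b = (D k, l)" "\<sigma> * k < 0"
    using l sign by (metis mult_eq_0_iff not_less_iff_gr_or_eq)
  then show ?case
  proof cases
    case 1
    then show ?thesis using diagonal central by blast
  next
    case 2
    then show ?thesis using diagonal diag by blast
  next
    case 3
    then have "uea_scalar a * gen b \<in> I"
      using raise I_mult by blast
    then show ?thesis
      by (simp add: uea_scalar_central[of a "gen b"] lowering_span.ideal)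
  next
    case 4
    then show ?thesis
      using lowering_span_neg[OF 4(2)] lowering_span.word lowering.scalar by blast
  qed
next
  case (step m u k j)
  have "gen b * (gen (D k, j) * u) = gen (D k, j) * (gen b * u) + uea_of (basis_bracket b (D k, j)) * u"
    by (simp add: X_commute[of b] distrib_right flip: mult.assoc)
  moreover have "gen (D k, j) * (gen b * u) \<in> lowering_span \<sigma> I"
    using step by (intro lowering_span_neg)
  moreover have "uea_of (basis_bracket b (D k, j)) * u \<in> lowering_span \<sigma> I"
    by (rule uea_of_mem[OF subspace_lowering_span]) (rule step.IH)
  ultimately show ?case
    by (simp add: lowering_span.add)
qed

lemma lowering_span_UNIV: "u \<in> lowering_span \<sigma> I"
proof (induction u rule: uea_induct)
  case (scalar a)
  then show ?case by (blast intro: lowering_span.word lowering.scalar)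
next
  case (add u v)
  then show ?case by (rule lowering_span.add)
next
  case (gen b u)
  then show ?case
  proof (induction u rule: lowering_span.induct)
    case (word m u)
    then show ?case by (rule X_lowering)
  next
    case (ideal u)
    then show ?case by (blast intro: lowering_span.ideal I_mult)
  next
    case (add u v)
    then show ?case by (simp add: distrib_left lowering_span.add)
  qed
qed

lemma lowering_weight:
  "lowering \<sigma> m u \<Longrightarrow> gen (D 0, 0) * u - uea_scalar (\<phi> 0 + of_int m) * u \<in> I"
proof (induction rule: lowering.induct)
  case (scalar a)
  have "gen (D 0, 0) * uea_scalar a - uea_scalar (\<phi> 0) * uea_scalar a
    = uea_scalar a * (gen (D 0, 0) - uea_scalar (\<phi> 0))"
    by (simp add: right_diff_distrib uea_scalar_central[of a "gen (D 0, 0)"]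
        uea_scalar_central[of "\<phi> 0" "uea_scalar a"])
  then show ?case
    using I_mult[OF diag] by simp
next
  case (step m u k j)
  have "k \<noteq> 0"
    using step by auto
  then have "gen (D 0, 0) * (gen (D k, j) * u) =
    gen (D k, j) * (gen (D 0, 0) * u) + uea_scalar (of_int k) * (gen (D k, j) * u)"
    using uea_of_single[of "(D k, j)" "of_int k"]
    by (simp add: X_commute[of "(D 0, 0)"] distrib_right flip: mult.assoc)
  then have "gen (D 0, 0) * (gen (D k, j) * u) - uea_scalar (\<phi> 0 + of_int (m + k)) * (gen (D k, j) * u)
    = gen (D k, j) * (gen (D 0, 0) * u - uea_scalar (\<phi> 0 + of_int m) * u)"
    by (simp add: right_diff_distrib uea_scalar_add distrib_right distrib_left
        uea_scalar_left_commute[of "gen (D k, j)"])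
  then show ?case
    using I_mult step by simp
qed

text \<open>The scalar is the part of \<open>u\<close> of weight \<phi> 0 modulo \<open>I\<close>:
  words of degree m \<noteq> 0 have the different weight \<phi> 0 + m.\<close>

lemma separated_scalar:
  "\<exists>a. U.separated_from (\<lambda>u. gen (D 0, 0) * u) I (\<phi> 0) (u - uea_scalar a)"
  using lowering_span_UNIV[of u]
proof (induction u rule: lowering_span.induct)
  case (word m u)
  show ?case
  proof (cases "m = 0")
    case True
    then obtain a where "u = uea_scalar a"
      using word lowering_degree by blast
    then show ?thesis
      using U.subspace_0[OF subspace_I] by (intro exI[of _ a] U.separated_from_mem) simp
  next
    case False
    have "U.separated_from (\<lambda>u. gen (D 0, 0) * u) I (\<phi> 0) u"
      by (rule U.separated_from_eigen[OF lin_mult_left subspace_I _ lowering_weight[OF word]])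
        (use False I_mult in auto)
    then show ?thesis
      by (intro exI[of _ 0]) simp
  qed
next
  case (ideal u)
  then show ?case
    by (intro exI[of _ 0] U.separated_from_mem) simp
next
  case (add u v)
  then obtain a b where "U.separated_from (\<lambda>u. gen (D 0, 0) * u) I (\<phi> 0) (u - uea_scalar a)"
    "U.separated_from (\<lambda>u. gen (D 0, 0) * u) I (\<phi> 0) (v - uea_scalar b)"
    by blast
  then have "U.separated_from (\<lambda>u. gen (D 0, 0) * u) I (\<phi> 0) ((u - uea_scalar a) + (v - uea_scalar b))"
    using I_mult by (intro U.separated_from_add lin_mult_left subspace_I) auto
  then show ?case
    by (intro exI[of _ "a + b"]) (simp add: uea_scalar_add algebra_simps)
qed

text \<open>
  In terms of the module \<open>uea / I\<close> generated by the class \<open>v\<close> of \<open>1\<close>: a submodule which is not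
  contained in the maximal submodule \<open>J / I\<close> contains some \<open>u v\<close> with \<open>u - 1\<close> in \<open>J\<close>, and the component of
  weight \<open>\<phi> 0\<close> of \<open>u v\<close> is \<open>v\<close> itself.
\<close>

lemma one_mem_left_ideal:
  assumes J: "left_ideal J" "I \<subseteq> J" "1 \<notin> J" and N: "left_ideal N" "I \<subseteq> N" "u \<in> N" "u - 1 \<in> J"
  shows "1 \<in> N"
proof -
  let ?T = "\<lambda>u. gen (D 0, 0) * u"
  have mem_scalar: "1 \<in> L" if "left_ideal L" "uea_scalar c \<in> L" "c \<noteq> 0" for L c
  proof -
    have "uea_scalar (inverse c) * uea_scalar c \<in> L"
      using that by (simp add: left_ideal_def)
    then show ?thesis
      using that by (simp flip: uea_scalar_mult)
  qed
  obtain a p where p: "poly p (\<phi> 0) \<noteq> 0" "U.poly_comb p (\<lambda>i. (?T ^^ i) (u - uea_scalar a)) \<in> I"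
    using separated_scalar[of u] unfolding U.separated_from_def by blast
  have pc: "U.poly_comb p (\<lambda>i. (?T ^^ i) (x + y)) =
    U.poly_comb p (\<lambda>i. (?T ^^ i) x) + U.poly_comb p (\<lambda>i. (?T ^^ i) y)" for x y
    by (simp add: U.lin_add[OF U.lin_funpow[OF lin_mult_left]] U.poly_comb_vec_add)
  have stable: "U.poly_comb p (\<lambda>i. (?T ^^ i) x) \<in> L" if "left_ideal L" "x \<in> L" for x L
  proof (rule U.poly_comb_mem[OF left_ideal_subspace[OF that(1)]])
    show "(?T ^^ i) x \<in> L" for i
      using that by (induction i) (auto simp: left_ideal_def)
  qed
  have sc: "U.poly_comb p (\<lambda>i. (?T ^^ i) (uea_scalar c)) - uea_scalar (poly p (\<phi> 0) * c) \<in> I" for c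
    unfolding uea_scalar_mult
    by (rule U.poly_comb_eigen_mod[OF lin_mult_left subspace_I])
      (use I_mult lowering_weight[OF lowering.scalar[of _ c]] in auto)
  note diff = U.subspace_diff[OF left_ideal_subspace]
  \<comment> \<open>p(d_0) maps u - a into \<open>I\<close> and u - 1 into \<open>J\<close>, hence 1
    - a into \<open>J\<close>. As it acts on scalars by p(\<phi> 0) modulo \<open>I\<close>, this
    forces a = 1.\<close>
  have eq: "u - uea_scalar a = (u - 1) + uea_scalar (1 - a)"
    using uea_scalar_add[of "1 - a" a] by (simp add: algebra_simps)
  have "U.poly_comb p (\<lambda>i. (?T ^^ i) (u - uea_scalar a)) -
      U.poly_comb p (\<lambda>i. (?T ^^ i) (u - 1)) \<in> J"
    using p(2) J N(4) stable by (intro diff) auto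
  then have "U.poly_comb p (\<lambda>i. (?T ^^ i) (uea_scalar (1 - a))) \<in> J"
    by (simp add: eq pc)
  from diff[OF J(1) this subsetD[OF J(2) sc[of "1 - a"]]] have "uea_scalar (poly p (\<phi> 0) * (1 - a)) \<in> J"
    by simp
  then have "a = 1"
    using mem_scalar[OF J(1)] J(3) p(1) by fastforce
  \<comment> \<open>Now p(d_0) maps u - 1 into \<open>I\<close> and u into \<open>N\<close>, so
    \<open>N\<close> contains the non-zero scalar -p(\<phi> 0).\<close>
  have "U.poly_comb p (\<lambda>i. (?T ^^ i) (u + uea_scalar (- 1))) \<in> I"
    using p(2) by (simp add: \<open>a = 1\<close> uea_scalar_minus)
  then have "U.poly_comb p (\<lambda>i. (?T ^^ i) (u + uea_scalar (- 1))) - U.poly_comb p (\<lambda>i. (?T ^^ i) u) \<in> N"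
    using N stable by (intro diff) auto
  then have "U.poly_comb p (\<lambda>i. (?T ^^ i) (uea_scalar (- 1))) \<in> N"
    by (simp add: pc)
  from diff[OF N(1) this subsetD[OF N(2) sc[of "- 1"]]] have "uea_scalar (poly p (\<phi> 0) * (- 1)) \<in> N"
    by simp
  then show ?thesis
    using mem_scalar[OF N(1)] p(1) by fastforce
qed

end

subsection \<open>The action of the enveloping algebra on a module\<close>

sublocale loop_vir_module \<subseteq> complex_space
  by unfold_locales

context loop_vir_module
begin

lemma act_zero [simp]: "act 0 v = 0"
  using act_add[of 0 0 v] by simp

definition act_word :: "word \<Rightarrow> 'v \<Rightarrow> 'v"
  where "act_word w = foldr (\<lambda>b. act (Poly_Mapping.single b 1)) (letters w)"

definition act_tensor :: "tensor_alg \<Rightarrow> 'v \<Rightarrow> 'v"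
  where "act_tensor p v = (\<Sum>w\<in>Poly_Mapping.keys p. scale (Poly_Mapping.lookup p w) (act_word w v))"

text \<open>The choice of representative is harmless, because the defining ideal acts by zero
  (\<open>act_tensor_ideal\<close>).\<close>

definition act_uea :: "uea \<Rightarrow> 'v \<Rightarrow> 'v"
  where "act_uea u = act_tensor (rep_uea u)"

lemma lin_act_word: "lin (act_word w)"
proof -
  have "lin (foldr (\<lambda>b. act (Poly_Mapping.single b 1)) bs)" for bs
    by (induction bs) (auto intro!: linI simp: lin_add lin_scale act_add_right act_scale_right)
  then show ?thesis
    by (simp add: act_word_def)
qed

lemma act_word_plus: "act_word (w + w') v = act_word w (act_word w' v)"
  by (simp add: act_word_def plus_word_def)

lemma act_tensor_add: "act_tensor (p + q) v = act_tensor p v + act_tensor q v"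
  unfolding act_tensor_def by (rule setsum_keys_plus_distrib) (simp_all add: scale_left_distrib)

lemma act_tensor_single: "act_tensor (Poly_Mapping.single w a) v = scale a (act_word w v)"
  by (cases "a = 0") (simp_all add: act_tensor_def)

lemma act_tensor_minus: "act_tensor (p - q) v = act_tensor p v - act_tensor q v"
  using act_tensor_add[of "p - q" q v] by simp

lemma lin_act_tensor: "lin (act_tensor p)"
  by (rule linI)
    (simp_all add: act_tensor_def lin_add[OF lin_act_word] lin_scale[OF lin_act_word]
      scale_right_distrib sum.distrib scale_sum_right mult.commute)

lemma act_tensor_mult: "act_tensor (p * q) v = act_tensor p (act_tensor q v)"
proof (induction p rule: poly_mapping_additive_induct)
  case (single k a)
  show ?case
  proof (induction q rule: poly_mapping_additive_induct)
    case (single l b)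
    show ?case
      by (simp add: mult_single act_tensor_single act_word_plus lin_scale[OF lin_act_word])
  next
    case (add p q)
    then show ?case
      by (simp add: distrib_left act_tensor_add lin_add[OF lin_act_tensor])
  qed
next
  case (add p q)
  then show ?case
    by (simp add: distrib_right act_tensor_add)
qed

lemma act_tensor_of: "act_tensor (tensor_of x) v = act x v"
proof (induction x rule: poly_mapping_additive_induct)
  case (single b a)
  have "act (Poly_Mapping.single b a) v = scale a (act (Poly_Mapping.single b 1) v)"
    using act_scale[of a "Poly_Mapping.single b 1" v] by (simp add: loop_scale_single)
  then show ?case
    by (simp add: tensor_of_single act_tensor_single act_word_def)
next
  case (add x y)
  then show ?case
    by (simp add: tensor_of_add act_tensor_add act_add)
qed

lemma act_tensor_ideal: "p \<in> uea_ideal \<Longrightarrow> act_tensor p v = 0"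
proof (induction arbitrary: v rule: uea_ideal.induct)
  case zero
  show ?case by (simp add: act_tensor_def)
next
  case (relation x y)
  show ?case
    by (simp add: act_tensor_minus act_tensor_mult act_tensor_of act_bracket)
next
  case (mult_left p r)
  then show ?case by (simp add: act_tensor_mult lin_zero[OF lin_act_tensor])
qed (simp_all add: act_tensor_add act_tensor_mult)

lemma act_uea_abs: "act_uea (abs_uea p) v = act_tensor p v"
proof -
  have "abs_uea (rep_uea (abs_uea p)) = abs_uea p"
    by (rule Quotient3_abs_rep[OF Quotient3_uea])
  then have "rep_uea (abs_uea p) - p \<in> uea_ideal"
    by (simp add: uea.abs_eq_iff uea_rel_def)
  then show ?thesis
    using act_tensor_ideal[of "rep_uea (abs_uea p) - p" v] by (simp add: act_tensor_minus act_uea_def)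
qed

lemma act_uea_add: "act_uea (u + w) v = act_uea u v + act_uea w v"
proof (induction u rule: uea.abs_induct)
  case (1 p)
  show ?case
    by (induction w rule: uea.abs_induct) (simp add: plus_uea.abs_eq act_uea_abs act_tensor_add)
qed

lemma act_uea_mult: "act_uea (u * w) v = act_uea u (act_uea w v)"
proof (induction u rule: uea.abs_induct)
  case (1 p)
  show ?case
    by (induction w rule: uea.abs_induct) (simp add: times_uea.abs_eq act_uea_abs act_tensor_mult)
qed

lemma act_uea_scalar: "act_uea (uea_scalar a) v = scale a v"
  by (simp add: uea_scalar.abs_eq act_uea_abs act_tensor_single act_word_def zero_word_def)

lemma act_uea_of: "act_uea (uea_of x) v = act x v"
  by (simp add: uea_of.abs_eq act_uea_abs act_tensor_of)

lemma act_uea_one [simp]: "act_uea 1 v = v"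
  using act_uea_scalar[of 1 v] by simp

lemma act_uea_zero [simp]: "act_uea 0 v = 0"
  using act_uea_scalar[of 0 v] by simp

lemma act_uea_minus: "act_uea (u - w) v = act_uea u v - act_uea w v"
  using act_uea_add[of "u - w" w v] by simp

lemma lin_act_uea: "lin (act_uea u)"
  unfolding act_uea_def by (rule lin_act_tensor)

lemma left_ideal_annihilator: "left_ideal {u. act_uea u v = 0}"
  by (simp add: left_ideal_def act_uea_add act_uea_mult lin_zero[OF lin_act_uea])

section \<open>The module as a structure carried by a set\<close>

lemma comm_group_lmod_of: "comm_group (lmod_of scale act)"
proof (rule comm_groupI)
  fix x assume "x \<in> carrier (lmod_of scale act)"
  show "\<exists>y\<in>carrier (lmod_of scale act). y \<otimes>\<^bsub>lmod_of scale act\<^esub> x = \<one>\<^bsub>lmod_of scale act\<^esub>"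
    by (intro bexI[of _ "- x"]) (simp_all add: lmod_of_def)
qed (simp_all add: lmod_of_def add_ac)

lemma lsubmodule_lmod_of:
  assumes "subspace N" "\<And>x v. v \<in> N \<Longrightarrow> act x v \<in> N"
  shows "lsubmodule N (lmod_of scale act)"
proof -
  interpret V: comm_group "lmod_of scale act" by (rule comm_group_lmod_of)
  have inv: "inv\<^bsub>lmod_of scale act\<^esub> v = - v" for v
    by (rule V.inv_equality) (simp_all add: lmod_of_def)
  have "subgroup N (lmod_of scale act)"
  proof
    show "inv\<^bsub>lmod_of scale act\<^esub> v \<in> N" if "v \<in> N" for v
      unfolding inv using assms(1) that by (rule subspace_neg)
  qed (use assms(1) in \<open>auto simp: lmod_of_def subspace_add subspace_0\<close>)
  then show ?thesis
    using assms by (auto simp: lsubmodule_def lmod_of_def subspace_scale)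
qed

lemma irreducible_subspace:
  assumes "irreducible_lmod (lmod_of scale act)" "subspace N" "\<And>x v. v \<in> N \<Longrightarrow> act x v \<in> N"
  shows "N = {0} \<or> N = UNIV"
proof -
  have "lsubmodule N (lmod_of scale act)"
    using assms(2,3) by (rule lsubmodule_lmod_of)
  then show ?thesis
    using assms(1) unfolding irreducible_lmod_def by (auto simp: lmod_of_def)
qed

text \<open>The orbit of \<open>v\<close> under the enveloping algebra is a submodule containing
  \<open>v\<close>.\<close>

lemma irreducible_cyclic:
  assumes "irreducible_lmod (lmod_of scale act)" "v \<noteq> 0"
  shows "\<exists>u. act_uea u v = w"
proof -
  let ?N = "range (\<lambda>u. act_uea u v)"
  have "subspace ?N"
  proof (rule subspaceI)
    show "0 \<in> ?N"
      by (rule range_eqI[of _ _ 0]) simp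
    show "x + y \<in> ?N" if "x \<in> ?N" "y \<in> ?N" for x y
      using that by (auto simp flip: act_uea_add)
    show "scale c x \<in> ?N" if "x \<in> ?N" for c x
      using that by (auto simp flip: act_uea_scalar act_uea_mult)
  qed
  moreover have "act x y \<in> ?N" if "y \<in> ?N" for x y
    using that by (auto simp flip: act_uea_of act_uea_mult)
  moreover have "v \<in> ?N"
    by (rule range_eqI[of _ _ 1]) simp
  ultimately have "?N = UNIV"
    using irreducible_subspace[OF assms(1), of ?N] assms(2) by blast
  then show ?thesis
    by (metis UNIV_I imageE)
qed

end

subsection \<open>Quotients of modules carried by sets\<close>

lemma comm_group_extend:
  assumes "comm_group R"
  shows "comm_group (monoid.extend R m)"
proof -
  interpret R: comm_group R by fact
  show ?thesis
  proof (rule comm_groupI)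
    fix x assume "x \<in> carrier (monoid.extend R m)"
    then show "\<exists>y\<in>carrier (monoid.extend R m). y \<otimes>\<^bsub>monoid.extend R m\<^esub> x = \<one>\<^bsub>monoid.extend R m\<^esub>"
      by (intro bexI[of _ "inv\<^bsub>R\<^esub> x"]) (simp_all add: monoid.defs)
  next
    fix x y assume "x \<in> carrier (monoid.extend R m)" "y \<in> carrier (monoid.extend R m)"
    then show "x \<otimes>\<^bsub>monoid.extend R m\<^esub> y = y \<otimes>\<^bsub>monoid.extend R m\<^esub> x"
      using R.m_comm by (simp add: monoid.defs)
  qed (simp_all add: monoid.defs R.m_assoc)
qed

text \<open>As \<open>g\<close> maps \<open>N\<close> into itself, the product of \<open>N\<close>
  with the image of a coset is a single coset.\<close>

lemma (in comm_group) coset_map_coset: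
  assumes N: "subgroup N G" and g: "g \<in> hom G G" "g ` N \<subseteq> N" and x: "x \<in> carrier G"
  shows "coset_map G N g (N #> x) = N #> g x"
proof -
  have Nc: "n \<in> carrier G" if "n \<in> N" for n
    using subgroup.mem_carrier[OF N that] .
  have gc: "g y \<in> carrier G" if "y \<in> carrier G" for y
    using g(1) that by (auto simp: hom_def)
  have eq: "n \<otimes> g (n' \<otimes> x) = (n \<otimes> g n') \<otimes> g x" if "n \<in> N" "n' \<in> N" for n n'
    using that x Nc gc hom_mult[OF g(1)] by (simp add: m_assoc)
  show ?thesis
  proof (intro equalityI subsetI)
    fix y assume "y \<in> coset_map G N g (N #> x)"
    then obtain n n' where n: "n \<in> N" "n' \<in> N" "y = n \<otimes> g (n' \<otimes> x)"
      by (auto simp: coset_map_def set_mult_def r_coset_def)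
    then have "n \<otimes> g n' \<in> N"
      using g(2) subgroup.m_closed[OF N] by blast
    then show "y \<in> N #> g x"
      using n eq by (auto simp: r_coset_def)
  next
    fix y assume "y \<in> N #> g x"
    then obtain n where n: "n \<in> N" "y = n \<otimes> g x"
      by (auto simp: r_coset_def)
    have "x \<in> N #> x"
      using x N by (simp add: rcos_self)
    then show "y \<in> coset_map G N g (N #> x)"
      using n by (auto simp: coset_map_def set_mult_def)
  qed
qed

text \<open>The first isomorphism theorem. The group isomorphism is inverted, because
  \<open>lmod_isomorphic\<close> asks for a map out of \<open>V\<close>.\<close>

lemma lmod_isomorphic_quotient:
  assumes M: "comm_group M" and V: "comm_group V" and f: "f \<in> hom M V" "f ` carrier M = carrier V"
    and scal: "\<And>a. scal M a \<in> hom M M" "\<And>a m. m \<in> carrier M \<Longrightarrow> f (scal M a m) = scal V a (f m)"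
    and lact: "\<And>x. lact M x \<in> hom M M" "\<And>x m. m \<in> carrier M \<Longrightarrow> f (lact M x m) = lact V x (f m)"
  shows "lmod_isomorphic V (lmod_quotient M (kernel M V f))"
proof -
  interpret M: comm_group M by fact
  interpret V: comm_group V by fact
  interpret f: group_hom M V f
    using f by unfold_locales
  let ?N = "kernel M V f" and ?h = "\<lambda>X. the_elem (f ` X)"
  let ?k = "inv_into (carrier (M Mod ?N)) ?h"
  have N: "subgroup ?N M"
    by (rule f.subgroup_kernel)
  have h_iso: "?h \<in> iso (M Mod ?N) V"
    using f(2) by (rule f.FactGroup_iso_set)
  have k_iso: "?k \<in> iso V (M Mod ?N)"
    using normal.factorgroup_is_group[OF f.normal_kernel] h_iso by (rule group.iso_set_sym)
  have h_coset: "?h (?N #>\<^bsub>M\<^esub> m) = f m" if "m \<in> carrier M" for m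
  proof -
    have "f ` (?N #>\<^bsub>M\<^esub> m) = {f m}"
    proof -
      have "f (n \<otimes>\<^bsub>M\<^esub> m) = f m" if "n \<in> ?N" for n
        using that \<open>m \<in> carrier M\<close> by (auto simp: kernel_def)
      moreover have "m \<in> ?N #>\<^bsub>M\<^esub> m"
        using that N by (simp add: M.rcos_self)
      ultimately show ?thesis
        by (auto simp: r_coset_def)
    qed
    then show ?thesis by simp
  qed
  have k_f: "?k (f m) = ?N #>\<^bsub>M\<^esub> m" if "m \<in> carrier M" for m
  proof -
    have "?N #>\<^bsub>M\<^esub> m \<in> carrier (M Mod ?N)"
      using that by (auto simp: carrier_FactGroup)
    moreover have "inj_on ?h (carrier (M Mod ?N))"
      using h_iso by (auto simp: iso_def bij_betw_def)
    ultimately show ?thesis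
      using h_coset[OF that] by (metis inv_into_f_f)
  qed
  \<comment> \<open>Scalars and algebra elements are treated alike: \<open>f\<close> intertwines an
    endomorphism \<open>g\<close> of \<open>M\<close> with \<open>g'\<close> on
    \<open>V\<close>.\<close>
  have op: "?k (g' v) = coset_map M ?N g (?k v)"
    if g: "g \<in> hom M M" "\<And>m. m \<in> carrier M \<Longrightarrow> f (g m) = g' (f m)" and v: "v \<in> carrier V" for g g' v
  proof -
    obtain m where m: "m \<in> carrier M" "v = f m"
      using v f(2) by blast
    have gm: "g x \<in> carrier M" if "x \<in> carrier M" for x
      using g(1) that by (auto simp: hom_def)
    have "g \<one>\<^bsub>M\<^esub> = \<one>\<^bsub>M\<^esub>"
      using g(1) M.group_axioms by (simp add: hom_one)
    then have "g' \<one>\<^bsub>V\<^esub> = \<one>\<^bsub>V\<^esub>"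
      using g(2)[of "\<one>\<^bsub>M\<^esub>"] by simp
    then have "g ` ?N \<subseteq> ?N"
      using g(2) gm by (auto simp: kernel_def)
    then show ?thesis
      using M.coset_map_coset[OF N g(1) _ m(1)] k_f[OF m(1)] k_f[OF gm[OF m(1)]] g(2)[OF m(1)] m(2) by simp
  qed
  have "?k \<in> iso V (lmod_quotient M ?N)"
    using k_iso by (simp add: lmod_quotient_def iso_def hom_def monoid.defs)
  moreover have "?k (scal V a v) = scal (lmod_quotient M ?N) a (?k v)" if "v \<in> carrier V" for a v
    using op[OF scal(1) scal(2) that] by (simp add: lmod_quotient_def monoid.defs)
  moreover have "?k (lact V x v) = lact (lmod_quotient M ?N) x (?k v)" if "v \<in> carrier V" for x v
    using op[OF lact(1) lact(2) that] by (simp add: lmod_quotient_def monoid.defs)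
  ultimately show ?thesis
    unfolding lmod_isomorphic_def by (intro bexI[of _ ?k] ballI conjI allI)
qed

subsection \<open>The induced module as a quotient of the enveloping algebra\<close>

locale induced =
  fixes P :: "loop_vir set" and \<phi> :: "loop_vir \<Rightarrow> complex"
begin

abbreviation T :: "(uea \<times> complex \<Rightarrow>\<^sub>0 int) set"
  where "T \<equiv> tensor_relations P \<phi>"

abbreviation M :: "(uea \<times> complex \<Rightarrow>\<^sub>0 int) set lmod"
  where "M \<equiv> induced_module P \<phi>"

lemma T_subgroup: "subgroup T pair_group"
  unfolding tensor_relations_def
  by (rule group.generate_is_subgroup[OF group_free_Abelian_group]) auto

lemma T_zero: "0 \<in> T"
  using subgroup.one_closed[OF T_subgroup] by simp

lemma T_add: "x \<in> T \<Longrightarrow> y \<in> T \<Longrightarrow> x + y \<in> T"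
  using subgroup.m_closed[OF T_subgroup] by simp

lemma T_uminus: "x \<in> T \<Longrightarrow> - x \<in> T"
  using subgroup.m_inv_closed[OF T_subgroup, of x] by simp

lemma T_diff: "x \<in> T \<Longrightarrow> y \<in> T \<Longrightarrow> x - y \<in> T"
  using T_add[of x "- y"] T_uminus by simp

lemma T_additive: "frag_of (u + u', z) - frag_of (u, z) - frag_of (u', z) \<in> T"
  and T_additive_right: "frag_of (u, z + z') - frag_of (u, z) - frag_of (u, z') \<in> T"
  and T_balanced: "acts_on_v0 P \<phi> r a \<Longrightarrow> frag_of (u * r, z) - frag_of (u, a * z) \<in> T"
  unfolding tensor_relations_def by (rule generate.incl, blast)+

lemma T_induct [consumes 1, case_names zero additive additive_right balanced uminus add]:
  assumes "x \<in> T" and zero: "Q 0"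
    and "\<And>u u' z. Q (frag_of (u + u', z) - frag_of (u, z) - frag_of (u', z))"
    and "\<And>u z z'. Q (frag_of (u, z + z') - frag_of (u, z) - frag_of (u, z'))"
    and "\<And>u r a z. acts_on_v0 P \<phi> r a \<Longrightarrow> Q (frag_of (u * r, z) - frag_of (u, a * z))"
    and uminus: "\<And>x. Q x \<Longrightarrow> Q (- x)" and add: "\<And>x y. Q x \<Longrightarrow> Q y \<Longrightarrow> Q (x + y)"
  shows "Q x"
  using assms(1) unfolding tensor_relations_def
proof (induction x rule: generate.induct)
  case one
  then show ?case using zero by simp
next
  case (incl h)
  then show ?case using assms(3-5) by blast
next
  case (inv h)
  then have "Q h" using assms(3-5) by blast
  then show ?case using uminus by simp
next
  case (eng h1 h2)
  then show ?case using add by simp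
qed

definition cls :: "(uea \<times> complex \<Rightarrow>\<^sub>0 int) \<Rightarrow> (uea \<times> complex \<Rightarrow>\<^sub>0 int) set"
  where "cls x = T #>\<^bsub>pair_group\<^esub> x"

lemma cls_eq_iff: "cls x = cls y \<longleftrightarrow> x - y \<in> T"
proof
  assume "cls x = cls y"
  moreover have "x \<in> cls x"
    using T_zero by (auto simp: cls_def r_coset_def intro!: bexI[of _ 0])
  ultimately obtain t where "t \<in> T" "x = t + y"
    by (auto simp: cls_def r_coset_def)
  then show "x - y \<in> T" by simp
next
  assume *: "x - y \<in> T"
  have "cls x \<subseteq> cls y" if "x - y \<in> T" for x y
  proof
    fix w assume "w \<in> cls x"
    then obtain t where t: "t \<in> T" "w = t + x"
      by (auto simp: cls_def r_coset_def)
    then have "t + (x - y) \<in> T" "w = t + (x - y) + y"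
      using that T_add by auto
    then show "w \<in> cls y"
      unfolding cls_def r_coset_def by (auto intro!: bexI[of _ "t + (x - y)"])
  qed
  from this[OF *] this[of y x] show "cls x = cls y"
    using T_uminus[OF *] by auto
qed

lemma carrier_M: "carrier M = range cls"
  by (auto simp: induced_module_def monoid.defs carrier_FactGroup cls_def)

lemma one_M: "\<one>\<^bsub>M\<^esub> = cls 0"
proof -
  have "\<one>\<^bsub>M\<^esub> = T"
    by (simp add: induced_module_def monoid.defs)
  then show ?thesis
    by (simp add: cls_def r_coset_def)
qed

lemma mult_M: "cls x \<otimes>\<^bsub>M\<^esub> cls y = cls (x + y)"
proof -
  interpret comm_group pair_group by (rule abelian_free_Abelian_group)
  interpret normal T pair_group
    using T_subgroup by (rule subgroup_imp_normal)
  show ?thesis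
    using rcos_sum[of x y] by (simp add: induced_module_def monoid.defs cls_def)
qed

lemma comm_group_M: "comm_group M"
  unfolding induced_module_def
  by (intro comm_group_extend comm_group.abelian_FactGroup abelian_free_Abelian_group T_subgroup)

lemma pair_mult_frag_of [simp]: "pair_mult w (frag_of (u, z)) = frag_of (w * u, z)"
  by (simp add: pair_mult_def)

lemma pair_mult_add: "pair_mult w (x + y) = pair_mult w x + pair_mult w y"
  by (simp add: pair_mult_def frag_extend_add)

lemma pair_mult_diff: "pair_mult w (x - y) = pair_mult w x - pair_mult w y"
  by (simp add: pair_mult_def frag_extend_diff)

lemma pair_mult_zero [simp]: "pair_mult w 0 = 0"
  by (simp add: pair_mult_def)

lemma pair_mult_T: "x \<in> T \<Longrightarrow> pair_mult w x \<in> T"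
proof (induction x rule: T_induct)
  case (uminus x)
  then show ?case
    using pair_mult_diff[of w 0 x] T_uminus by simp
next
  case (balanced u r a z)
  then show ?case
    using T_balanced[of r a "w * u" z] by (simp add: pair_mult_diff mult.assoc)
qed (simp_all add: pair_mult_diff distrib_left T_additive T_additive_right T_zero pair_mult_add T_add)

lemma coset_map_cls: "coset_map pair_group T (pair_mult w) (cls x) = cls (pair_mult w x)"
  unfolding cls_def
  by (rule comm_group.coset_map_coset[OF abelian_free_Abelian_group T_subgroup])
    (auto simp: hom_def pair_mult_add pair_mult_T)

lemma scal_cls: "scal M a (cls x) = cls (pair_mult (uea_scalar a) x)"
  by (simp add: induced_module_def monoid.defs coset_map_cls)

lemma lact_cls: "lact M x (cls y) = cls (pair_mult (uea_of x) y)"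
  by (simp add: induced_module_def monoid.defs coset_map_cls)

text \<open>The class of u \<otimes> v_0. Scalars move across the tensor sign, so every class has
  this form and the induced module is U / I.\<close>

definition chi :: "uea \<Rightarrow> (uea \<times> complex \<Rightarrow>\<^sub>0 int) set"
  where "chi u = cls (frag_of (u, 1))"

lemma chi_add: "chi (u + v) = chi u \<otimes>\<^bsub>M\<^esub> chi v"
  using T_additive[of u v 1] by (simp add: chi_def mult_M cls_eq_iff diff_diff_eq)

lemma chi_zero: "chi 0 = \<one>\<^bsub>M\<^esub>"
  using T_uminus[OF T_additive[of 0 0 1]] by (simp add: chi_def one_M cls_eq_iff)

lemma chi_scalar: "chi (u * uea_scalar z) = cls (frag_of (u, z))"
  using T_balanced[OF acts_on_v0.scalar, of u z 1] by (simp add: chi_def cls_eq_iff)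

lemma cls_chi: "\<exists>u. cls x = chi u"
proof -
  have "Poly_Mapping.keys x \<subseteq> UNIV" by simp
  then show ?thesis
  proof (induction x rule: frag_induction)
    case zero
    then show ?case using chi_zero one_M by metis
  next
    case (one x)
    then show ?case using chi_scalar by (metis surj_pair)
  next
    case (diff a b)
    then obtain u v where uv: "a - frag_of (u, 1) \<in> T" "b - frag_of (v, 1) \<in> T"
      by (auto simp: chi_def cls_eq_iff)
    have "((a - frag_of (u, 1)) - (b - frag_of (v, 1))) +
        (frag_of (u, 1) - frag_of (u - v, 1) - frag_of (v, 1)) \<in> T"
      using T_additive[of "u - v" v 1] by (intro T_add T_diff[OF uv]) simp
    then have "(a - b) - frag_of (u - v, 1) \<in> T"
      by (simp add: algebra_simps)
    then show ?case
      by (auto simp: chi_def cls_eq_iff)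
  qed
qed


lemma carrier_chi: "carrier M = range chi"
proof
  show "range chi \<subseteq> carrier M"
    by (auto simp: carrier_M chi_def)
  show "carrier M \<subseteq> range chi"
    unfolding carrier_M using cls_chi by (metis image_subsetI rangeI)
qed

lemma scal_chi: "scal M a (chi u) = chi (uea_scalar a * u)"
  by (simp add: chi_def scal_cls)

lemma lact_chi: "lact M x (chi u) = chi (uea_of x * u)"
  by (simp add: chi_def lact_cls)

lemma scal_hom: "scal M a \<in> hom M M"
  by (auto simp: hom_def carrier_chi scal_chi distrib_left simp flip: chi_add)

lemma lact_hom: "lact M x \<in> hom M M"
  by (auto simp: hom_def carrier_chi lact_chi distrib_left simp flip: chi_add)

text \<open>Stability under scalars and generators gives stability under all of U by
  \<open>uea_induct\<close>. Submodules are thus handled as left ideals.\<close>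

lemma left_ideal_chi:
  assumes "lsubmodule N M"
  shows "left_ideal {u. chi u \<in> N}"
proof -
  have N: "subgroup N M" "\<And>a v. v \<in> N \<Longrightarrow> scal M a v \<in> N" "\<And>x v. v \<in> N \<Longrightarrow> lact M x v \<in> N"
    using assms by (auto simp: lsubmodule_def)
  have add: "chi (u + v) \<in> N" if "chi u \<in> N" "chi v \<in> N" for u v
    unfolding chi_add using N(1) that by (rule subgroup.m_closed)
  have "chi (w * u) \<in> N" if "chi u \<in> N" for w u
  proof (induction w rule: uea_induct)
    case (scalar a)
    show ?case using N(2)[OF that] by (simp add: scal_chi)
  next
    case (add v w)
    then show ?case using \<open>\<And>u v. chi u \<in> N \<Longrightarrow> chi v \<in> N \<Longrightarrow> chi (u + v) \<in> N\<close>
      by (simp add: distrib_right)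
  next
    case (gen b w)
    then show ?case using N(3) by (simp add: lact_chi[symmetric] mult.assoc)
  qed
  then show ?thesis
    using add subgroup.one_closed[OF N(1)] by (simp add: left_ideal_def chi_zero)
qed

definition I :: "uea set"
  where "I = {u. chi u = \<one>\<^bsub>M\<^esub>}"

lemma left_ideal_I: "left_ideal I"
proof -
  have "lsubmodule {\<one>\<^bsub>M\<^esub>} M"
    unfolding lsubmodule_def
  proof (intro conjI ballI allI)
    show "subgroup {\<one>\<^bsub>M\<^esub>} M"
      by (intro group.triv_subgroup comm_group.axioms(2) comm_group_M)
    show "scal M a v \<in> {\<one>\<^bsub>M\<^esub>}" if "v \<in> {\<one>\<^bsub>M\<^esub>}" for a v
      using that scal_chi[of a 0] by (simp add: chi_zero)
    show "lact M x v \<in> {\<one>\<^bsub>M\<^esub>}" if "v \<in> {\<one>\<^bsub>M\<^esub>}" for x v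
      using that lact_chi[of x 0] by (simp add: chi_zero)
  qed
  from left_ideal_chi[OF this] show ?thesis
    by (simp add: I_def)
qed

text \<open>r \<otimes> v_0 = 1 \<otimes> a v_0 = a \<otimes> v_0.\<close>

lemma acts_on_v0_I:
  assumes "acts_on_v0 P \<phi> r a"
  shows "r - uea_scalar a \<in> I"
proof -
  interpret M: comm_group M by (rule comm_group_M)
  have "chi r = cls (frag_of (1, a))"
    using T_balanced[OF assms, of 1 1] by (simp add: chi_def cls_eq_iff)
  also have "\<dots> = chi (uea_scalar a)"
    using chi_scalar[of 1 a] by simp
  finally have "chi (r - uea_scalar a) \<otimes>\<^bsub>M\<^esub> chi (uea_scalar a) = chi (uea_scalar a)"
    by (simp flip: chi_add)
  then show ?thesis
    using M.r_cancel_one[of "chi (uea_scalar a)" "chi (r - uea_scalar a)"] by (simp add: I_def carrier_chi)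
qed

end

locale extremal_vector = loop_vir_module scale act + induced P \<phi>
  for scale :: "complex \<Rightarrow> 'v::ab_group_add \<Rightarrow> 'v" and act P \<phi> +
  fixes \<sigma> :: int and v0 :: 'v
  assumes irreducible: "irreducible_lmod (lmod_of scale act)"
    and P_eq: "P = loop_graded {i. \<sigma> * i > 0}"
    and sign: "\<sigma> \<noteq> 0"
    and linear_form: "linear_form_on loop_zero \<phi>"
    and v0: "v0 \<noteq> 0"
    and act_zero_v0: "x \<in> loop_zero \<Longrightarrow> act x v0 = scale (\<phi> x) v0"
    and act_P_v0: "x \<in> P \<Longrightarrow> act x v0 = 0"
begin

abbreviation V :: "'v lmod"
  where "V \<equiv> lmod_of scale act"

lemma acts_on_v0: "acts_on_v0 P \<phi> r a \<Longrightarrow> act_uea r v0 = scale a v0"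
proof (induction rule: acts_on_v0.induct)
  case (lie x y)
  then show ?case
    by (simp add: act_uea_of act_add act_zero_v0 act_P_v0)
next
  case (mult r a s b)
  then show ?case
    by (simp add: act_uea_mult lin_scale[OF lin_act_uea] mult.commute)
qed (simp_all add: act_uea_scalar act_uea_add scale_left_distrib)

text \<open>The additive extension of u \<otimes> z v_0 -> z u v_0. It vanishes on the tensor
  relations, so it is constant on cosets and \<open>eval_cls\<close> is its descent to the induced
  module.\<close>

definition eval_pairs :: "(uea \<times> complex \<Rightarrow>\<^sub>0 int) \<Rightarrow> 'v"
  where "eval_pairs x = (\<Sum>k\<in>Poly_Mapping.keys x.
    scale (of_int (Poly_Mapping.lookup x k) * snd k) (act_uea (fst k) v0))"

lemma eval_pairs_add: "eval_pairs (x + y) = eval_pairs x + eval_pairs y"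
  unfolding eval_pairs_def
  by (rule setsum_keys_plus_distrib) (simp_all add: distrib_right scale_left_distrib)

lemma eval_pairs_diff: "eval_pairs (x - y) = eval_pairs x - eval_pairs y"
  using eval_pairs_add[of "x - y" y] by simp

lemma eval_pairs_frag_of [simp]: "eval_pairs (frag_of (u, z)) = scale z (act_uea u v0)"
  by (simp add: eval_pairs_def)

lemma eval_pairs_T: "x \<in> T \<Longrightarrow> eval_pairs x = 0"
proof (induction x rule: T_induct)
  case zero
  then show ?case by (simp add: eval_pairs_def)
next
  case (uminus x)
  then show ?case using eval_pairs_diff[of 0 x] by (simp add: eval_pairs_def)
next
  case (balanced u r a z)
  then show ?case
    by (simp add: eval_pairs_diff act_uea_mult acts_on_v0 lin_scale[OF lin_act_uea] mult.commute)
qed (simp_all add: eval_pairs_diff eval_pairs_add act_uea_add scale_right_distrib scale_left_distrib)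

definition eval_cls :: "(uea \<times> complex \<Rightarrow>\<^sub>0 int) set \<Rightarrow> 'v"
  where "eval_cls K = the_elem (eval_pairs ` K)"

lemma eval_cls_chi: "eval_cls (chi u) = act_uea u v0"
proof -
  have "eval_pairs ` chi u = {act_uea u v0}"
    using T_zero by (force simp: chi_def cls_def r_coset_def eval_pairs_add eval_pairs_T)
  then show ?thesis
    by (simp add: eval_cls_def)
qed

lemma eval_cls_hom: "eval_cls \<in> hom M V"
  by (auto simp: hom_def carrier_chi eval_cls_chi act_uea_add lmod_of_def simp flip: chi_add)

lemma eval_cls_surj: "eval_cls ` carrier M = carrier V"
proof -
  have "eval_cls ` carrier M = range (\<lambda>u. act_uea u v0)"
    by (simp add: carrier_chi image_image eval_cls_chi)
  moreover have "w \<in> range (\<lambda>u. act_uea u v0)" for w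
    using irreducible_cyclic[OF irreducible v0, of w] by blast
  ultimately show ?thesis
    by (auto simp: lmod_of_def)
qed

sublocale extremal_ideal \<sigma> I "\<lambda>j. \<phi> (Poly_Mapping.single (D 0, j) 1)"
  "\<lambda>j. \<phi> (Poly_Mapping.single (C, j) 1)"
proof
  \<comment> \<open>The rule \<open>lie\<close> sees a raising generator as 0 + y, so it gives the
    scalar \<phi> 0, which must be 0.\<close>
  have "0 \<in> loop_zero"
    by (simp add: loop_graded_def)
  then have "\<phi> (0 + 0) = \<phi> 0 + \<phi> 0"
    using linear_form unfolding linear_form_on_def by blast
  then have "\<phi> 0 = 0"
    by simp
  fix k j
  show "gen (D k, j) \<in> I" if "\<sigma> * k > 0"
    using acts_on_v0_I[OF acts_on_v0.lie, of 0 "Poly_Mapping.single (D k, j) 1"] that \<open>\<phi> 0 = 0\<close>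
    by (simp add: P_eq loop_graded_def)
next
  fix j
  show "gen (D 0, j) - uea_scalar (\<phi> (Poly_Mapping.single (D 0, j) 1)) \<in> I"
    using acts_on_v0_I[OF acts_on_v0.lie, of "Poly_Mapping.single (D 0, j) 1" 0]
    by (simp add: P_eq loop_graded_def)
  show "gen (C, j) - uea_scalar (\<phi> (Poly_Mapping.single (C, j) 1)) \<in> I"
    using acts_on_v0_I[OF acts_on_v0.lie, of "Poly_Mapping.single (C, j) 1" 0]
    by (simp add: P_eq loop_graded_def)
qed (rule sign left_ideal_I)+

section \<open>The unique maximal proper submodule\<close>

lemma kernel_eval: "kernel M V eval_cls = chi ` {u. act_uea u v0 = 0}"
  by (auto simp: kernel_def carrier_chi eval_cls_chi lmod_of_def)

lemma lsubmodule_kernel: "lsubmodule (kernel M V eval_cls) M"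
proof -
  interpret M: comm_group M by (rule comm_group_M)
  interpret V: comm_group V by (rule comm_group_lmod_of)
  interpret eval: group_hom M V eval_cls
    using eval_cls_hom by unfold_locales
  show ?thesis
    unfolding lsubmodule_def
    using eval.subgroup_kernel
    by (auto simp: kernel_eval scal_chi lact_chi act_uea_mult lin_zero[OF lin_act_uea])
qed

text \<open>If u v_0 \<noteq> 0, irreducibility of \<open>V\<close> yields w with w u v_0 = v_0.
  Then w u - 1 annihilates v_0, and \<open>one_mem_left_ideal\<close> applies with the annihilator
  of v_0 as \<open>J\<close>.\<close>

lemma lsubmodule_not_in_kernel:
  assumes "lsubmodule N M" "\<not> N \<subseteq> kernel M V eval_cls"
  shows "N = carrier M"
proof -
  have N: "left_ideal {u. chi u \<in> N}"
    using assms(1) by (rule left_ideal_chi)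
  have "subgroup N M"
    using assms(1) by (simp add: lsubmodule_def)
  then have sub: "N \<subseteq> range chi"
    using subgroup.subset carrier_chi by blast
  moreover obtain y where y: "y \<in> N" "y \<notin> kernel M V eval_cls"
    using assms(2) by blast
  ultimately obtain u where "y = chi u"
    by blast
  then have u: "chi u \<in> N" "act_uea u v0 \<noteq> 0"
    using y by (auto simp: kernel_eval)
  obtain w where w: "act_uea w (act_uea u v0) = v0"
    using irreducible_cyclic[OF irreducible u(2)] by blast
  have "1 \<in> {u. chi u \<in> N}"
  proof (rule one_mem_left_ideal[OF left_ideal_annihilator _ _ N])
    show "I \<subseteq> {u. act_uea u v0 = 0}"
    proof
      fix r assume "r \<in> I"
      then have "eval_cls (chi r) = eval_cls (chi 0)"
        by (simp add: I_def chi_zero)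
      then show "r \<in> {u. act_uea u v0 = 0}"
        by (simp add: eval_cls_chi)
    qed
    show "1 \<notin> {u. act_uea u v0 = 0}"
      using v0 by simp
    show "I \<subseteq> {u. chi u \<in> N}"
      using \<open>subgroup N M\<close> by (auto simp: I_def intro: subgroup.one_closed)
    show "w * u \<in> {u. chi u \<in> N}"
      using N u by (simp add: left_ideal_def)
    show "w * u - 1 \<in> {u. act_uea u v0 = 0}"
      using w by (simp add: act_uea_minus act_uea_mult)
  qed
  then have "chi v \<in> N" for v
    using N unfolding left_ideal_def by (metis (mono_tags) mem_Collect_eq mult.right_neutral)
  then show ?thesis
    using sub by (auto simp: carrier_chi)
qed

lemma kernel_eval_proper: "kernel M V eval_cls \<noteq> carrier M"
proof
  assume "kernel M V eval_cls = carrier M"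
  then have "chi 1 \<in> kernel M V eval_cls"
    by (simp add: carrier_chi)
  then show False
    using v0 by (simp add: kernel_def eval_cls_chi lmod_of_def)
qed

text \<open>Every submodule outside the kernel is everything; this resolves the definite description
  in \<open>irreducible_quotient\<close>.\<close>

lemma maximal_proper_unique: "maximal_proper_lsubmodule N M \<longleftrightarrow> N = kernel M V eval_cls"
proof
  assume N: "maximal_proper_lsubmodule N M"
  then have "N \<subseteq> kernel M V eval_cls"
    using lsubmodule_not_in_kernel[of N] unfolding maximal_proper_lsubmodule_def by blast
  then show "N = kernel M V eval_cls"
    using N lsubmodule_kernel kernel_eval_proper unfolding maximal_proper_lsubmodule_def by blast
next
  have "N' = kernel M V eval_cls \<or> N' = carrier M"
    if "lsubmodule N' M" "kernel M V eval_cls \<subseteq> N'" for N'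
    using lsubmodule_not_in_kernel[OF that(1)] that(2) by blast
  moreover assume "N = kernel M V eval_cls"
  ultimately show "maximal_proper_lsubmodule N M"
    using lsubmodule_kernel kernel_eval_proper unfolding maximal_proper_lsubmodule_def by blast
qed

theorem isomorphic_irreducible_quotient: "lmod_isomorphic V (irreducible_quotient P \<phi>)"
proof -
  have "(THE N. maximal_proper_lsubmodule N M) = kernel M V eval_cls"
    by (simp add: maximal_proper_unique)
  moreover have "lmod_isomorphic V (lmod_quotient M (kernel M V eval_cls))"
  proof (rule lmod_isomorphic_quotient[OF comm_group_M comm_group_lmod_of eval_cls_hom eval_cls_surj
        scal_hom _ lact_hom])
    show "eval_cls (scal M a m) = scal V a (eval_cls m)" if "m \<in> carrier M" for a m
      using that by (auto simp: carrier_chi scal_chi eval_cls_chi act_uea_mult act_uea_scalar) (simp add: lmod_of_def)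
    show "eval_cls (lact M x m) = lact V x (eval_cls m)" if "m \<in> carrier M" for x m
      using that by (auto simp: carrier_chi lact_chi eval_cls_chi act_uea_mult act_uea_of) (simp add: lmod_of_def)
  qed
  ultimately show ?thesis
    by (simp add: irreducible_quotient_def)
qed

end

subsection \<open>Weight vectors annihilated by one half of the algebra\<close>

context loop_vir_module
begin

lemma act_single: "act (Poly_Mapping.single b a) v = scale a (act (Poly_Mapping.single b 1) v)"
  using act_scale[of a "Poly_Mapping.single b 1" v] by (simp add: loop_scale_single)

lemma act_mem:
  assumes "subspace R" "\<And>b. b \<in> Poly_Mapping.keys x \<Longrightarrow> act (Poly_Mapping.single b 1) v \<in> R"
  shows "act x v \<in> R"
  using assms(2)
proof (induction x rule: update_induct)
  case const
  show ?case using assms(1) by (simp add: subspace_0)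
next
  case (update f a b)
  have "act f v \<in> R"
    using update by (simp add: keys_update)
  moreover have "act (Poly_Mapping.single a b) v \<in> R"
    unfolding act_single[of a b] using update assms(1) by (simp add: keys_update subspace_scale)
  ultimately show ?case
    using assms(1) update(1) by (simp add: update_eq_add act_add subspace_add)
qed

lemma extremal_weight_moduleI:
  assumes irr: "irreducible_lmod (lmod_of scale act)" and "\<sigma> \<noteq> 0" and v: "v \<noteq> 0"
    and raise: "\<And>k j. \<sigma> * k > 0 \<Longrightarrow> act (Poly_Mapping.single (D k, j) 1) v = 0"
    and diag: "\<And>j. \<exists>a. act (Poly_Mapping.single (D 0, j) 1) v = scale a v"
      "\<And>j. \<exists>a. act (Poly_Mapping.single (C, j) 1) v = scale a v"
  shows "extremal_weight_module (loop_graded {i. \<sigma> * i > 0}) scale act"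
proof -
  \<comment> \<open>On \<open>loop_zero\<close> the chosen scalar is unique because \<open>v\<close>
    is non-zero, which gives linearity there.\<close>
  define \<phi> where "\<phi> x = (SOME a. act x v = scale a v)" for x
  have act_zero_v: "act x v = scale (\<phi> x) v" if "x \<in> loop_zero" for x
  proof -
    have "act x v \<in> span {v}"
    proof (rule act_mem[OF subspace_span])
      fix b assume "b \<in> Poly_Mapping.keys x"
      then have "vir_degree b = 0"
        using that by (auto simp: loop_graded_def)
      then obtain a where "act (Poly_Mapping.single b 1) v = scale a v"
        using diag by (cases b rule: vir_degree.cases) auto
      then show "act (Poly_Mapping.single b 1) v \<in> span {v}"
        by (simp add: span_scale span_base)
    qed
    then have "\<exists>a. act x v = scale a v"
      by (auto simp: span_singleton)
    then show ?thesis
      unfolding \<phi>_def by (rule someI_ex)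
  qed
  have act_P: "act x v = 0" if x: "x \<in> loop_graded {i. \<sigma> * i > 0}" for x
  proof -
    have "act x v \<in> {0}"
    proof (rule act_mem[OF subspace_single_0])
      fix b assume "b \<in> Poly_Mapping.keys x"
      then have "\<sigma> * vir_degree b > 0"
        using x by (auto simp: loop_graded_def)
      then show "act (Poly_Mapping.single b 1) v \<in> {0}"
        using raise by (cases b rule: vir_degree.cases) auto
    qed
    then show ?thesis by simp
  qed
  have linear: "linear_form_on loop_zero \<phi>"
    unfolding linear_form_on_def
  proof (intro conjI ballI allI)
    fix x y assume xy: "x \<in> loop_zero" "y \<in> loop_zero"
    then have "x + y \<in> loop_zero"
      using keys_add[of x y] unfolding loop_graded_def by blast
    then have "scale (\<phi> (x + y)) v = scale (\<phi> x + \<phi> y) v"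
      using xy by (simp add: act_add scale_left_distrib flip: act_zero_v)
    then show "\<phi> (x + y) = \<phi> x + \<phi> y"
      using v by simp
  next
    fix a x assume x: "x \<in> loop_zero"
    have "Poly_Mapping.keys (loop_scale a x) \<subseteq> Poly_Mapping.keys x"
      by (auto simp: in_keys_iff lookup_loop_scale)
    with x have "loop_scale a x \<in> loop_zero"
      unfolding loop_graded_def by blast
    then have "scale (\<phi> (loop_scale a x)) v = scale (a * \<phi> x) v"
      using x by (simp add: act_scale flip: act_zero_v scale_scale)
    then show "\<phi> (loop_scale a x) = a * \<phi> x"
      using v by simp
  qed
  interpret extremal_vector scale act "loop_graded {i. \<sigma> * i > 0}" \<phi> \<sigma> v
    by unfold_locales (use assms linear act_zero_v act_P in auto)
  have "loop_vir_module scale act"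
    by unfold_locales
  then show ?thesis
    unfolding extremal_weight_module_def using irr linear isomorphic_irreducible_quotient by blast
qed

lemma loop_hc:
  assumes irr: "irreducible_lmod (lmod_of scale act)" and hc: harish_chandra_module
  shows "loop_hc scale (\<lambda>k j. act (Poly_Mapping.single (D k, j) 1)) (\<lambda>j. act (Poly_Mapping.single (C, j) 1))"
proof -
  have comm: "act (Poly_Mapping.single a 1) (act (Poly_Mapping.single b 1) v) =
    act (Poly_Mapping.single b 1) (act (Poly_Mapping.single a 1) v) + act (basis_bracket a b) v" for a b v
    using act_bracket[of "Poly_Mapping.single a 1" "Poly_Mapping.single b 1" v] by (simp add: bracket_single)
  interpret ops: loop_ops scale "\<lambda>k j. act (Poly_Mapping.single (D k, j) 1)" "\<lambda>j. act (Poly_Mapping.single (C, j) 1)"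
  proof
    fix i j k l v
    have "act (basis_bracket (D i, j) (D k, l)) v =
      scale (of_int (k - i)) (act (Poly_Mapping.single (D (i + k), j + l) 1) v) +
      (if i + k = 0 then scale (of_int (i ^ 3 - i) / 12) (act (Poly_Mapping.single (C, j + l) 1) v) else 0)"
      using act_single[of "(D (i + k), j + l)" "of_int (k - i)"]
        act_single[of "(C, j + l)" "of_int (i ^ 3 - i) / 12"] by (simp add: act_add)
    then show "act (Poly_Mapping.single (D i, j) 1) (act (Poly_Mapping.single (D k, l) 1) v) =
      act (Poly_Mapping.single (D k, l) 1) (act (Poly_Mapping.single (D i, j) 1) v) +
      scale (of_int (k - i)) (act (Poly_Mapping.single (D (i + k), j + l) 1) v) +
      (if i + k = 0 then scale (of_int (i ^ 3 - i) / 12) (act (Poly_Mapping.single (C, j + l) 1) v) else 0)"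
      using comm[of "(D i, j)" "(D k, l)" v] by (simp only: add.assoc)
    show "act (Poly_Mapping.single (D k, j) 1) (act (Poly_Mapping.single (C, l) 1) v) =
      act (Poly_Mapping.single (C, l) 1) (act (Poly_Mapping.single (D k, j) 1) v)"
      using comm[of "(D k, j)" "(C, l)" v] by simp
    show "act (Poly_Mapping.single (C, j) 1) (act (Poly_Mapping.single (C, l) 1) v) =
      act (Poly_Mapping.single (C, l) 1) (act (Poly_Mapping.single (C, j) 1) v)"
      using comm[of "(C, j)" "(C, l)" v] by simp
  qed (simp_all add: act_add_right act_scale_right)
  have wt: "ops.wt \<mu> = weight_space \<mu>" for \<mu>
    by (simp add: ops.wt_def weight_space_def d0_def)
  show ?thesis
  proof
    show "\<exists>B. finite B \<and> span B = ops.wt \<mu>" for \<mu>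
      using hc by (simp add: wt harish_chandra_module_def finite_dim_def)
    show "\<exists>\<mu>. ops.wt \<mu> \<noteq> {0}"
    proof (rule ccontr)
      assume "\<not> ?thesis"
      then have "span (\<Union>\<mu>. weight_space \<mu>) = {0}"
        by (simp add: wt)
      then show False
        using hc irr by (simp add: harish_chandra_module_def weight_module_def irreducible_lmod_def lmod_of_def)
    qed
  next
    fix U
    assume U: "subspace U"
      and D: "\<And>k j v. v \<in> U \<Longrightarrow> act (Poly_Mapping.single (D k, j) 1) v \<in> U"
      and C: "\<And>j v. v \<in> U \<Longrightarrow> act (Poly_Mapping.single (C, j) 1) v \<in> U"
    have basis: "act (Poly_Mapping.single b 1) v \<in> U" if "v \<in> U" for b v
      using that D C by (cases b rule: vir_degree.cases) auto
    have "act x v \<in> U" if "v \<in> U" for x v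
      by (rule act_mem[OF U]) (rule basis[OF that])
    then show "U = {0} \<or> U = UNIV"
      by (rule irreducible_subspace[OF irr U])
  qed
qed

end

theorem theorem3p1:
  fixes scale :: "complex \<Rightarrow> 'v::ab_group_add \<Rightarrow> 'v"
    and act :: "loop_vir \<Rightarrow> 'v \<Rightarrow> 'v"
  assumes "loop_vir_module scale act"
    and "irreducible_lmod (lmod_of scale act)"
    and "loop_vir_module.harish_chandra_module scale act"
  shows "highest_weight_module scale act \<or> lowest_weight_module scale act \<or>
    loop_vir_module.uniformly_bounded_module scale act"
proof -
  interpret loop_vir_module scale act by fact
  interpret ops: loop_hc scale "\<lambda>k j. act (Poly_Mapping.single (D k, j) 1)" "\<lambda>j. act (Poly_Mapping.single (C, j) 1)"
    using assms(2,3) by (rule loop_hc)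
  have wt: "ops.wt \<mu> = weight_space \<mu>" for \<mu>
    by (simp add: ops.wt_def weight_space_def d0_def)
  \<comment> \<open>Both extremal cases pass from a weight vector killed by one half to a common
    eigenvector of L_0; \<sigma> selects the half.\<close>
  have extremal: "extremal_weight_module (loop_graded {i. \<sigma> * i > 0}) scale act"
    if w: "w \<in> ops.wt \<nu>" "w \<noteq> 0" and \<sigma>: "\<sigma> \<noteq> 0"
      and raise: "\<And>k j. \<sigma> * k > 0 \<Longrightarrow> act (Poly_Mapping.single (D k, j) 1) w = 0" for \<nu> w \<sigma>
  proof -
    obtain v where "v \<noteq> 0"
      "\<And>k j. \<sigma> * k > 0 \<Longrightarrow> act (Poly_Mapping.single (D k, j) 1) v = 0"
      "\<And>j. \<exists>a. act (Poly_Mapping.single (D 0, j) 1) v = scale a v"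
      "\<And>j. \<exists>a. act (Poly_Mapping.single (C, j) 1) v = scale a v"
      using ops.common_eigenvector[OF w, of "{k. \<sigma> * k > 0}"] raise by auto
    then show ?thesis
      using assms(2) \<sigma> by (intro extremal_weight_moduleI)
  qed
  consider "\<not> ops.no_highest" | "\<not> ops.no_lowest" | "ops.no_lowest" "ops.no_highest"
    by blast
  then show ?thesis
  proof cases
    case 1
    then obtain \<nu> w where "w \<in> ops.wt \<nu>" "w \<noteq> 0" "\<And>k j. k > 0 \<Longrightarrow> act (Poly_Mapping.single (D k, j) 1) w = 0"
      unfolding ops.no_highest_def by blast
    then have "extremal_weight_module (loop_graded {i. 1 * i > 0}) scale act"
      by (intro extremal) auto
    then have "highest_weight_module scale act"
      by (simp add: highest_weight_module_def greaterThan_def)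
    then show ?thesis by blast
  next
    case 2
    then obtain \<nu> w where "w \<in> ops.wt \<nu>" "w \<noteq> 0" "\<And>k j. k < 0 \<Longrightarrow> act (Poly_Mapping.single (D k, j) 1) w = 0"
      unfolding ops.no_lowest_def by blast
    then have "extremal_weight_module (loop_graded {i. - 1 * i > 0}) scale act"
      by (intro extremal) auto
    then have "lowest_weight_module scale act"
      by (simp add: lowest_weight_module_def lessThan_def)
    then show ?thesis by blast
  next
    case 3
    then have "\<exists>N. \<forall>\<mu>. weight_space \<mu> \<noteq> {0} \<longrightarrow> dim (weight_space \<mu>) < N"
      using ops.weight_dims_bounded by (simp add: wt)
    then have uniformly_bounded_module
      using assms(3) unfolding uniformly_bounded_module_def harish_chandra_module_def by blast
    then show ?thesis by blast
  qed
qed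

end
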